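(* Let $m\in\mathbb{Z}$ with $m\geq 1$, and let $\beta_k>0$, $\lambda_k>0$, $\delta_k\geq 0$, $\gamma_k\in\mathbb{R}$ for $k=1,\ldots,m$. Suppose that (1) $\displaystyle\sum_{k=1}^m \frac{1}{\lambda_k}=\sum_{k=1}^m\frac{1}{\beta_k}$; (2) $\displaystyle\sum_{k=1}^m\delta_k>0$; (3) $\displaystyle\min_{1\leq k\leq m}(\gamma_k+1)\lambda_k>1$. Let $$I_{(\beta_k),(\lambda_k),m}^{(\gamma_k),(\delta_k)}f(x)=\int_0^1 H_{m,m}^{m,0}\left[u\left|\begin{matrix}(\gamma_k+\delta_k+1-1/\beta_k,\,1/\beta_k)_{1,m}\\(\gamma_k+1-1/\lambda_k,\,1/\lambda_k)_{1,m}\end{matrix}\right.\right]f(xu)\,\mathrm{d}u ,$$ where $H_{m,m}^{m,0}$ is the Fox $H$-function. Then for every $f\in H^1(\mathbb{R})$, $$\left\|I_{(\beta_k),(\lambda_k),m}^{(\gamma_k),(\delta_k)}f\right\|_{H^1}\leq \mathsf{k}_1\,\|f\|_{H^1},$$ where $$\mathsf{k}_1=\int_0^1\left|H_{m,m}^{m,0}\left[\sigma\left|\begin{matrix}(\gamma_k+\delta_k+1-1/\beta_k,\,1/\beta_k)_{1,m}\\(\gamma_k+1-1/\lambda_k,\,1/\lambda_k)_{1,m}\end{matrix}\right.\right]\right|\frac{\mathrm{d}\sigma}{\sigma}.$$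
   Context: **Fox $H$-function.** For parameters $a_k,b_k$ and $A_k,B_k>0$ ($k=1,\ldots,m$) with $\sum_{k=1}^m A_k=\sum_{k=1}^m B_k$, $$H_{m,m}^{m,0}\left[z\left|\begin{matrix}(a_k,A_k)_{1,m}\\(b_k,B_k)_{1,m}\end{matrix}\right.\right]=\frac{1}{2\pi\mathrm{i}}\int_{L}\prod_{k=1}^m\frac{\Gamma(B_ks+b_k)}{\Gamma(A_ks+a_k)}\,z^{-s}\,\mathrm{d}s,$$ where $(a_k,A_k)_{1,m}$ abbreviates $(a_1,A_1),\ldots,(a_m,A_m)$, and $L=L_{-\infty}$ is a left loop situated in a horizontal strip, starting at $-\infty+\mathrm{i}\varphi_1$ and terminating at $-\infty+\mathrm{i}\varphi_2$ with $-\infty<\varphi_1<\varphi_2<\infty$, which encloses all the poles of the functions $\Gamma(B_ks+b_k)$, $k=1,\ldots,m$. With this contour the $H$-function makes sense for $0<|z|<R$, where $R:=\prod_{k=1}^m A_k^{-A_k}\prod_{k=1}^m B_k^{B_k}$. **Hardy space.** A tempered distribution $f$ on $\mathbb{R}$ is called bounded if $f*\varphi\in L^\infty(\mathbb{R})$ for every Schwartz function $\varphi$. Let $P(x)=\frac{1}{\pi}\frac{1}{1+|x|^2}$ and $P_t(x)=t^{-1}P(x/t)$ for $t>0$. A bounded tempered distribution $f$ belongs to $H^1=H^1(\mathbb{R})$ if the Poisson maximal function $M_Pf(x)=\sup_{t>0}|(P_t*f)(x)|$ lies in $L^1(\mathbb{R})$, and then $\|f\|_{H^1}=\|M_Pf\|_{L^1}$.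 It is known that $H^1\subset L^1(\mathbb{R})$. *)

theory Defs
  imports "HOL-Complex_Analysis.Complex_Analysis"
begin

section \<open>The Fox H-function $H^{m,0}_{m,m}$\<close>

text \<open>
  A left loop is given by its bounded part, a path \<open>g\<close>.  The loop runs along the horizontal ray from
  $-\infty + \mathrm{i}\varphi_1$ to the start of \<open>g\<close>, along \<open>g\<close>, and back along the horizontal ray from
  the end of \<open>g\<close> to $-\infty + \mathrm{i}\varphi_2$.  Hence $\varphi_1$ and $\varphi_2$ are the imaginary
  parts of the two end points of \<open>g\<close>.  Being compact, \<open>g\<close> keeps the loop inside a horizontal strip.
  The loop cut off at real part \<open>- T\<close> and closed up by a vertical segment is:
\<close>

definition closed_up_loop :: "(real \<Rightarrow> complex) \<Rightarrow> real \<Rightarrow> (real \<Rightarrow> complex)" where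
  "closed_up_loop g T =
     (let lower = Complex (- T) (Im (pathstart g)); upper = Complex (- T) (Im (pathfinish g))
      in linepath lower (pathstart g) +++ g +++ linepath (pathfinish g) upper +++ linepath upper lower)"

text \<open>
  A point is enclosed by the loop if it is encircled once, counterclockwise, by the closed-up loops
  with sufficiently distant cut.  There may be infinitely many points, so the cut depends on the point.
\<close>

definition left_loop :: "(real \<Rightarrow> complex) \<Rightarrow> complex set \<Rightarrow> bool" where
  "left_loop g P \<longleftrightarrow>
     valid_path g \<and> Im (pathstart g) < Im (pathfinish g) \<and>
     (\<forall>p\<in>P. eventually (\<lambda>T. p \<notin> path_image (closed_up_loop g T) \<and>
                           winding_number (closed_up_loop g T) p = 1) at_top)"

definition loop_integral :: "(real \<Rightarrow> complex) \<Rightarrow> (complex \<Rightarrow> complex) \<Rightarrow> complex" where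
  "loop_integral g f =
     (LINT x:{..Re (pathstart g)}|lborel. f (Complex x (Im (pathstart g))))
     + contour_integral g f
     - (LINT x:{..Re (pathfinish g)}|lborel. f (Complex x (Im (pathfinish g))))"

definition gamma_poles :: "nat \<Rightarrow> (nat \<Rightarrow> complex) \<Rightarrow> (nat \<Rightarrow> real) \<Rightarrow> complex set" where
  "gamma_poles m b B = {s. \<exists>k\<in>{1..m}. of_real (B k) * s + b k \<in> \<int>\<^sub>\<le>\<^sub>0}"

definition fox_radius :: "nat \<Rightarrow> (nat \<Rightarrow> real) \<Rightarrow> (nat \<Rightarrow> real) \<Rightarrow> real" where
  "fox_radius m A B = (\<Prod>k=1..m. A k powr (- A k)) * (\<Prod>k=1..m. B k powr B k)"

text \<open>
  The library sets \<open>Gamma\<close> to 0 at its poles, and division by 0 gives 0; so the factors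
  \<open>1 / Gamma (A k * s + a k)\<close> below are the entire function $1/\Gamma$, also at the poles of $\Gamma$.
\<close>

definition fox_integrand ::
  "nat \<Rightarrow> (nat \<Rightarrow> complex) \<Rightarrow> (nat \<Rightarrow> real) \<Rightarrow> (nat \<Rightarrow> complex) \<Rightarrow> (nat \<Rightarrow> real) \<Rightarrow> complex \<Rightarrow> complex \<Rightarrow> complex"
  where
  "fox_integrand m a A b B z s =
     (\<Prod>k=1..m. Gamma (of_real (B k) * s + b k) / Gamma (of_real (A k) * s + a k)) * z powr (- s)"

text \<open>
  The contour integral converges for \<open>0 < |z| < R\<close> and does not depend on the left loop, so any loop may
  be selected; one exists by \<open>left_loop_exists\<close> below.  For \<open>|z| \<ge> R\<close> the integral over the left loop is
  not available, and the function is given the value 0.  This is the usual continuation: for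
  \<open>|z| > R\<close> one closes the contour to the right, where the integrand has no poles.  The power
  \<open>z powr (- s)\<close> uses the principal branch; for positive \<open>z\<close> it is the real one.
\<close>

definition fox_H ::
  "nat \<Rightarrow> (nat \<Rightarrow> complex) \<Rightarrow> (nat \<Rightarrow> real) \<Rightarrow> (nat \<Rightarrow> complex) \<Rightarrow> (nat \<Rightarrow> real) \<Rightarrow> complex \<Rightarrow> complex"
  where
  "fox_H m a A b B z =
     (if 0 < norm z \<and> norm z < fox_radius m A B
      then loop_integral (SOME g. left_loop g (gamma_poles m b B)) (fox_integrand m a A b B z)
             / (2 * of_real pi * \<i>)
      else 0)"

lemma left_loop_exists:
  assumes "\<And>k. k \<in> {1..m} \<Longrightarrow> B k > 0"
  shows "\<exists>g. left_loop g (gamma_poles m b B)"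
proof -
  define M where "M = (\<Sum>k=1..m. norm (b k) / B k) + 1"
  have pos: "0 \<le> norm (b k) / B k" if "k \<in> {1..m}" for k
    using assms[OF that] by simp
  have nonneg: "0 \<le> (\<Sum>k=1..m. norm (b k) / B k)"
    by (intro sum_nonneg pos)
  define g where "g = linepath (Complex M (- M)) (Complex M M)"
  have closed: "closed_up_loop g T = rectpath (Complex (- T) (- M)) (Complex M M)" for T
    by (simp add: closed_up_loop_def g_def rectpath_def Let_def)
  have bound: "Re p < M \<and> \<bar>Im p\<bar> < M" if p: "p \<in> gamma_poles m b B" for p
  proof -
    from p obtain k n where k: "k \<in> {1..m}" and n: "of_real (B k) * p + b k = - of_nat n"
      unfolding gamma_poles_def by (auto elim!: nonpos_Ints_cases')
    have "norm (b k) / B k \<le> (\<Sum>k=1..m. norm (b k) / B k)"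
      by (rule member_le_sum[OF k]) (use pos in blast, simp)
    then have le: "norm (b k) / B k < M" by (simp add: M_def)
    have Bk: "B k > 0" using assms k by blast
    have "Re (of_real (B k) * p + b k) \<le> 0" "Im (of_real (B k) * p + b k) = 0"
      unfolding n by auto
    then have eq: "B k * Re p \<le> - Re (b k)" "B k * Im p = - Im (b k)" by auto
    have ab: "\<bar>Re (b k)\<bar> \<le> norm (b k)" "\<bar>Im (b k)\<bar> \<le> norm (b k)"
      by (rule abs_Re_le_cmod abs_Im_le_cmod)+
    have "Re p \<le> norm (b k) / B k"
      using eq ab Bk by (simp add: field_simps)
    moreover have "\<bar>Im p\<bar> * B k = \<bar>Im (b k)\<bar>"
      using eq Bk by (metis abs_minus_cancel abs_mult abs_of_pos mult.commute)
    then have "\<bar>Im p\<bar> \<le> norm (b k) / B k"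
      using ab Bk by (simp add: field_simps)
    ultimately show ?thesis using le by linarith
  qed
  have "eventually (\<lambda>T. p \<notin> path_image (closed_up_loop g T) \<and>
                        winding_number (closed_up_loop g T) p = 1) at_top"
    if p: "p \<in> gamma_poles m b B" for p
    using eventually_gt_at_top[of "\<bar>Re p\<bar> + M"]
  proof eventually_elim
    case (elim T)
    have "p \<in> box (Complex (- T) (- M)) (Complex M M)"
      using elim bound[OF p] nonneg by (auto simp: in_box_complex_iff M_def)
    moreover have "- T \<le> M" using elim nonneg by (auto simp: M_def)
    ultimately show ?case
      using elim nonneg
      by (auto simp: closed winding_number_rectpath path_image_rectpath_cbox_minus_box M_def)
  qed
  then have "left_loop g (gamma_poles m b B)"
    unfolding left_loop_def using nonneg by (auto simp: g_def M_def)
  then show ?thesis by (rule exI[of _ g])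
qed


section \<open>The Hardy space $H^1$\<close>

text \<open>
  Functions and distributions are complex-valued.  A tempered distribution is represented by a
  functional on all functions, of which only the values on Schwartz functions matter.  Continuity is
  domination by finitely many of the seminorms that define the Schwartz topology.
\<close>

definition iter_deriv :: "nat \<Rightarrow> (real \<Rightarrow> complex) \<Rightarrow> (real \<Rightarrow> complex)" where
  "iter_deriv k = (\<lambda>\<phi> x. vector_derivative \<phi> (at x)) ^^ k"

definition schwartz :: "(real \<Rightarrow> complex) \<Rightarrow> bool" where
  "schwartz \<phi> \<longleftrightarrow>
     (\<forall>k x. iter_deriv k \<phi> differentiable (at x)) \<and>
     (\<forall>j k. bounded (range (\<lambda>x. x ^ j *\<^sub>R iter_deriv k \<phi> x)))"

definition schwartz_seminorm :: "nat \<Rightarrow> nat \<Rightarrow> (real \<Rightarrow> complex) \<Rightarrow> real" where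
  "schwartz_seminorm j k \<phi> = (SUP x. norm (x ^ j *\<^sub>R iter_deriv k \<phi> x))"

definition tempered_distribution :: "((real \<Rightarrow> complex) \<Rightarrow> complex) \<Rightarrow> bool" where
  "tempered_distribution T \<longleftrightarrow>
     (\<forall>\<phi> \<psi>. schwartz \<phi> \<longrightarrow> schwartz \<psi> \<longrightarrow> T (\<lambda>x. \<phi> x + \<psi> x) = T \<phi> + T \<psi>) \<and>
     (\<forall>c \<phi>. schwartz \<phi> \<longrightarrow> T (\<lambda>x. c * \<phi> x) = c * T \<phi>) \<and>
     (\<exists>C N. \<forall>\<phi>. schwartz \<phi> \<longrightarrow> norm (T \<phi>) \<le> C * (\<Sum>j\<le>N. \<Sum>k\<le>N. schwartz_seminorm j k \<phi>))"

definition distr_conv :: "((real \<Rightarrow> complex) \<Rightarrow> complex) \<Rightarrow> (real \<Rightarrow> complex) \<Rightarrow> real \<Rightarrow> complex" where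
  "distr_conv T \<phi> x = T (\<lambda>y. \<phi> (x - y))"

definition bounded_distribution :: "((real \<Rightarrow> complex) \<Rightarrow> complex) \<Rightarrow> bool" where
  "bounded_distribution T \<longleftrightarrow> tempered_distribution T \<and>
     (\<forall>\<phi>. schwartz \<phi> \<longrightarrow> (\<exists>C. AE x in lborel. norm (distr_conv T \<phi> x) \<le> C))"

definition poisson_kernel :: "real \<Rightarrow> real \<Rightarrow> real" where
  "poisson_kernel t x = (1 / pi) * (1 / (1 + \<bar>x / t\<bar>\<^sup>2)) / t"

text \<open>
  The Poisson kernel is not a Schwartz function.  For a bounded tempered distribution \<open>T\<close>, the
  convolution $P_t * T$ is the distribution
  $\varphi \mapsto \int (T * \tilde\varphi)(y)\, \tilde{P_t}(y)\, \mathrm{d}y$ with the reflection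
  $\tilde\varphi(x) = \varphi(-x)$; the integral converges as $T * \tilde\varphi$ is bounded and $P_t$ is
  integrable.  This distribution is given by a unique bounded continuous function.
\<close>

definition poisson_conv :: "((real \<Rightarrow> complex) \<Rightarrow> complex) \<Rightarrow> real \<Rightarrow> real \<Rightarrow> complex" where
  "poisson_conv T t = (THE h. continuous_on UNIV h \<and> bounded (range h) \<and>
     (\<forall>\<phi>. schwartz \<phi> \<longrightarrow>
        (LINT y|lborel. h y * \<phi> y) =
        (LINT y|lborel. distr_conv T (\<lambda>x. \<phi> (- x)) y * of_real (poisson_kernel t (- y)))))"

definition poisson_maximal :: "((real \<Rightarrow> complex) \<Rightarrow> complex) \<Rightarrow> real \<Rightarrow> ennreal" where
  "poisson_maximal T x = (SUP t\<in>{0<..}. ennreal (norm (poisson_conv T t x)))"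

definition hardy_distribution :: "((real \<Rightarrow> complex) \<Rightarrow> complex) \<Rightarrow> bool" where
  "hardy_distribution T \<longleftrightarrow> bounded_distribution T \<and>
     poisson_maximal T \<in> borel_measurable lborel \<and> (\<integral>\<^sup>+x. poisson_maximal T x \<partial>lborel) < \<infinity>"

definition distr_of :: "(real \<Rightarrow> complex) \<Rightarrow> (real \<Rightarrow> complex) \<Rightarrow> complex" where
  "distr_of f \<phi> = (LINT x|lborel. f x * \<phi> x)"

text \<open>
  As $H^1 \subset L^1$, every element of $H^1$ is the distribution of an integrable function;
  \<open>hardy_space\<close> consists of all functions that represent an element of $H^1$ in this way.
\<close>

definition hardy_space :: "(real \<Rightarrow> complex) set" where
  "hardy_space = {f. integrable lborel f \<and> hardy_distribution (distr_of f)}"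

definition hardy_norm :: "(real \<Rightarrow> complex) \<Rightarrow> ennreal" where
  "hardy_norm f = (\<integral>\<^sup>+x. poisson_maximal (distr_of f) x \<partial>lborel)"


section \<open>The integral operator\<close>

definition kernel_H ::
  "nat \<Rightarrow> (nat \<Rightarrow> real) \<Rightarrow> (nat \<Rightarrow> real) \<Rightarrow> (nat \<Rightarrow> real) \<Rightarrow> (nat \<Rightarrow> real) \<Rightarrow> real \<Rightarrow> complex"
  where
  "kernel_H m \<beta> lam \<gamma> \<delta> u =
     fox_H m (\<lambda>k. of_real (\<gamma> k + \<delta> k + 1 - 1 / \<beta> k)) (\<lambda>k. 1 / \<beta> k)
             (\<lambda>k. of_real (\<gamma> k + 1 - 1 / lam k)) (\<lambda>k. 1 / lam k) (of_real u)"

definition op_I ::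
  "nat \<Rightarrow> (nat \<Rightarrow> real) \<Rightarrow> (nat \<Rightarrow> real) \<Rightarrow> (nat \<Rightarrow> real) \<Rightarrow> (nat \<Rightarrow> real) \<Rightarrow>
    (real \<Rightarrow> complex) \<Rightarrow> real \<Rightarrow> complex"
  where
  "op_I m \<beta> lam \<gamma> \<delta> f x = (LINT u:{0<..<1}|lborel. kernel_H m \<beta> lam \<gamma> \<delta> u * f (x * u))"

definition const_k1 ::
  "nat \<Rightarrow> (nat \<Rightarrow> real) \<Rightarrow> (nat \<Rightarrow> real) \<Rightarrow> (nat \<Rightarrow> real) \<Rightarrow> (nat \<Rightarrow> real) \<Rightarrow> real"
  where
  "const_k1 m \<beta> lam \<gamma> \<delta> = (LINT \<sigma>:{0<..<1}|lborel. norm (kernel_H m \<beta> lam \<gamma> \<delta> \<sigma>) / \<sigma>)"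

end

theory Submission
  imports Defs "HOL-Probability.Sinc_Integral" "HOL-Real_Asymp.Real_Asymp"
begin

text \<open>
  The operator averages the dilations $f(u\,\cdot)$ with weight $H(u)$, and
  $P_t * f(u\,\cdot) = (P_{tu} * f)(u\,\cdot)$.  Hence $M_P(If)(x) \le \int_0^1 |H(u)|\,M_Pf(xu)\,\mathrm{d}u$,
  and integrating over $x$ gives the bound with the factor $\int_0^1 |H(u)|\,\mathrm{d}u/u$.

  That this factor is finite is read off the left loop.  By the residue theorem the loop may be replaced by
  two horizontal rays joined by a vertical segment at real part $-c$, where $c > 0$ keeps all poles to the
  left; such $c$ exists by (3).  On the rays the reflection formula moves the Gamma quotient to the right
  half-plane, where Stirling's formula bounds it by $C R^{-x} x^{-\Delta}$ at real part $-x$, with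
  $\Delta = \sum_k \delta_k > 0$.  With $\rho = \min(1, R)$, integrating $u^{x-1}$ over $0 < u < \rho$ first
  leaves $\int_c^\infty x^{-\Delta-1}\,\mathrm{d}x < \infty$, also if $R \le 1$, where $H$ may be unbounded near $R$.
\<close>

section \<open>Decay of Gamma quotients to the left\<close>

text \<open>\<open>fox_H\<close> integrates along a loop selected by \<open>SOME\<close>, so only
  what holds for every left loop may be used. The poles are real and tend to minus infinity; a loop
  that encloses them all has its two rays on opposite sides of the real axis, so both rays have
  nonzero height. On such a line the sine of the reflection formula is bounded away from 0, and in a
  bounded strip the modulus of Gamma is comparable to its value at the real part. Hence Stirling's
  formula is wanted on the real axis only, up to a bounded error. In the sum of the Stirling
  exponents the terms x ln x and x cancel because the 1/\<lambda>_k and the 1/\<beta>_k have equal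
  sums; the terms with ln (A_k) and ln (B_k) produce R; the coefficient of ln x is the sum of b_k -
  a_k, which the same equality turns into -\<Delta>. On the Hardy side the obstacle is that
  \<open>poisson_conv\<close> is a definite description: for integrable functions it must first be
  identified with a convolution integral, and uniqueness there needs enough concrete Schwartz
  functions.\<close>

text \<open>For the error \<open>L\<close>, the difference L(x) - L(x+1) is (x + 1/2) (ln (x+1) - ln
  x) - 1. The midpoint and trapezoidal rules for the integral of 1/t put it between 0 and 1/(4x) -
  1/(4(x+1)). These bounds telescope, so the values on the compact interval [1,2] control all the
  others.\<close>

lemma ln_Gamma_stirling_bounded:
  obtains K where "\<And>x::real. x \<ge> 1 \<Longrightarrow> \<bar>ln_Gamma x - ((x - 1/2) * ln x - x)\<bar> \<le> K"
proof -
  define L where "L = (\<lambda>x::real. ln_Gamma x - ((x - 1/2) * ln x - x))"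
  have step: "L (x + 1) \<le> L x \<and> L x \<le> L (x + 1) + (1 / (4 * x) - 1 / (4 * (x + 1)))" if "x > 0" for x :: real
  proof -
    have "ln_Gamma (x + 1) = ln x + ln_Gamma x"
      using that by (subst (1 2) ln_Gamma_real_pos)
        (auto simp: Gamma_plus1 add.commute[of 1] nonpos_Ints_def intro!: ln_mult_pos)
    then have eq: "L x - L (x + 1) = (x + 1/2) * (ln (x + 1) - ln x) - 1"
      by (simp add: L_def algebra_simps)
    have "2 * (x + 1 - x) / (x + (x + 1)) \<le> ln (x + 1) - ln x"
      using ln_inverse_approx_ge[of x "x + 1"] that by simp
    then have "1 \<le> (x + 1/2) * (ln (x + 1) - ln x)"
      using that by (simp add: field_simps)
    moreover have "ln (x + 1) - ln x \<le> (inverse x + inverse (x + 1)) / 2"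
      using ln_inverse_approx_le[of x 1] that by simp
    then have "(x + 1/2) * (ln (x + 1) - ln x) \<le> (x + 1/2) * ((inverse x + inverse (x + 1)) / 2)"
      using that by (intro mult_left_mono) auto
    moreover have "(x + 1/2) * ((inverse x + inverse (x + 1)) / 2) - 1 = 1 / (4 * x) - 1 / (4 * (x + 1))"
      using that by (simp add: divide_simps) algebra
    ultimately show ?thesis using eq by linarith
  qed
  have tel: "L (x + real n) \<le> L x \<and> L x \<le> L (x + real n) + (1 / (4 * x) - 1 / (4 * (x + real n)))"
    if "x > 0" for x :: real and n
  proof (induction n)
    case (Suc n)
    then show ?case using step[of "x + real n"] that by (simp add: algebra_simps)
  qed simp
  have "continuous_on {1..2} L"
    unfolding L_def
    by (intro continuous_intros DERIV_continuous_on[OF has_field_derivative_ln_Gamma_real]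
          DERIV_atLeastAtMost_imp_continuous_on exI) (auto intro!: has_field_derivative_ln_Gamma_real)
  then have "bounded (L ` {1..2})"
    by (intro compact_imp_bounded compact_continuous_image) auto
  then obtain K where K: "\<And>x. x \<in> {1..2} \<Longrightarrow> \<bar>L x\<bar> \<le> K"
    unfolding bounded_iff ball_simps real_norm_def by blast
  have "\<bar>L x\<bar> \<le> K + 1" if x: "x \<ge> 1" for x
  proof -
    define n where "n = nat \<lfloor>x - 1\<rfloor>"
    define y where "y = x - real n"
    have n: "real n \<le> x - 1" "x - 1 < real n + 1" using x unfolding n_def by linarith+
    then have y: "y \<in> {1..2}" by (auto simp: y_def)
    have "L x \<le> L y" "L y \<le> L x + (1 / (4 * y) - 1 / (4 * x))"
      using tel[of y n] y by (auto simp: y_def)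
    moreover have "1 / (4 * y) \<le> 1" "1 / (4 * x) \<ge> 0" using y x by (auto simp: field_simps)
    ultimately show ?thesis using K[OF y] by linarith
  qed
  then show ?thesis using that[of "K + 1"] by (auto simp: L_def)
qed

text \<open>Stirling's expression at \<open>A * x + c\<close> differs from the main term by
  \<open>(A * x + c - 1/2) * ln (1 + c / A / x)\<close> and a constant; the product tends to
  \<open>c\<close>.\<close>

lemma ln_Gamma_affine_asymp:
  fixes A c :: real
  assumes A: "A > 0"
  shows "(\<lambda>x. ln_Gamma (A * x + c) - (A * x * ln A + A * x * ln x + (c - 1/2) * ln x - A * x)) \<in> O(\<lambda>_. 1)"
proof -
  obtain K where K: "\<And>x::real. x \<ge> 1 \<Longrightarrow> \<bar>ln_Gamma x - ((x - 1/2) * ln x - x)\<bar> \<le> K"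
    using ln_Gamma_stirling_bounded by blast
  have "eventually (\<lambda>x. A * x + c \<ge> 1) at_top" using A by real_asymp
  then have "(\<lambda>x. ln_Gamma (A * x + c) - ((A * x + c - 1/2) * ln (A * x + c) - (A * x + c))) \<in> O(\<lambda>_. 1)"
    by (intro bigoI[of _ K]) (auto elim!: eventually_mono dest: K)
  moreover have "(\<lambda>x. ((A * x + c - 1/2) * ln (A * x + c) - (A * x + c)) -
      (A * x * ln A + A * x * ln x + (c - 1/2) * ln x - A * x)) \<in> O(\<lambda>_. 1)"
  proof (rule landau_o.big.in_cong[THEN iffD2])
    show "eventually (\<lambda>x. ((A * x + c - 1/2) * ln (A * x + c) - (A * x + c)) -
      (A * x * ln A + A * x * ln x + (c - 1/2) * ln x - A * x) =
      (A * x + c - 1/2) * ln (1 + c / A / x) + ((c - 1/2) * ln A - c)) at_top"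
      using eventually_gt_at_top[of 0] \<open>eventually (\<lambda>x. A * x + c \<ge> 1) at_top\<close>
    proof eventually_elim
      case (elim x)
      then have "A * x + c = A * x * (1 + c / A / x)" using A by (simp add: field_simps)
      moreover have "1 + c / A / x > 0" using elim A by (simp add: field_simps)
      ultimately have "ln (A * x + c) = ln A + ln x + ln (1 + c / A / x)"
        using elim A by (metis ln_mult_pos mult_pos_pos)
      then show ?case by (simp add: algebra_simps)
    qed
    show "(\<lambda>x. (A * x + c - 1/2) * ln (1 + c / A / x) + ((c - 1/2) * ln A - c)) \<in> O(\<lambda>_. 1)"
    proof (intro sum_in_bigo)
      show "(\<lambda>x. (A * x + c - 1/2) * ln (1 + c / A / x)) \<in> O(\<lambda>_. 1)"
      \<comment> \<open>For \<open>c = 0\<close> the logarithm is identically 0; otherwise its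
        leading term is \<open>c / (A * x)\<close>, so each sign gets its own expansion.\<close>
      proof (cases c "0::real" rule: linorder_cases)
        case equal
        then show ?thesis by simp
      qed (use A in real_asymp)+
    qed auto
  qed
  ultimately have "(\<lambda>x. (ln_Gamma (A * x + c) - ((A * x + c - 1/2) * ln (A * x + c) - (A * x + c))) +
      (((A * x + c - 1/2) * ln (A * x + c) - (A * x + c)) -
      (A * x * ln A + A * x * ln x + (c - 1/2) * ln x - A * x))) \<in> O(\<lambda>_. 1)"
    by (rule sum_in_bigo)
  moreover have "(u - v) + (v - w) = u - w" for u v w :: real by simp
  ultimately show ?thesis by (simp only:)
qed

section \<open>Moduli of Gamma and sine off the real axis\<close>

text \<open>Since |n^z| depends on Re z only, Euler's limit reduces the comparison with the real
  Gamma function to the factors |X + j + iy| / (X + j). Each is at least 1 and at most exp (y^2 / (2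
  (j+1)^2)), and the 1/(j+1)^2 sum to at most 2. In a strip of bounded height the loss exp (-y^2) is
  bounded below by a positive constant.\<close>

lemma norm_Gamma_bounds:
  fixes X y :: real
  assumes X: "X \<ge> 1"
  shows "norm (Gamma (Complex X y)) \<le> Gamma X" "Gamma X * exp (- y\<^sup>2) \<le> norm (Gamma (Complex X y))"
proof -
  have cx: "Complex X y + of_nat j = Complex (X + real j) y" for j by (simp add: complex_eq_iff)
  have nz: "Complex X y + of_nat j \<noteq> 0" for j using X by (simp add: complex_eq_iff)
  have norm_ser: "norm (Gamma_series (Complex X y) n) * (\<Prod>j\<le>n. norm (Complex (X + real j) y)) =
      Gamma_series X n * (\<Prod>j\<le>n. X + real j)" for n
  proof -
    have "norm (Gamma_series (Complex X y) n) = fact n * exp (X * ln (real n)) / (\<Prod>j\<le>n. norm (Complex (X + real j) y))"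
      by (simp add: Gamma_series_def norm_mult norm_divide pochhammer_prod norm_exp cx
           prod_norm[symmetric] lessThan_Suc_atMost atLeast0LessThan atLeast0AtMost)
    moreover have "(\<Prod>j\<le>n. norm (Complex (X + real j) y)) \<noteq> 0" using nz cx by (auto simp: )
    moreover have "(\<Prod>j\<le>n. X + real j) \<noteq> 0" using X by (auto simp: add_nonneg_eq_0_iff)
    ultimately show ?thesis
      by (simp add: Gamma_series_def pochhammer_prod lessThan_Suc_atMost atLeast0LessThan atLeast0AtMost)
  qed
  have lim: "(\<lambda>n. norm (Gamma_series (Complex X y) n)) \<longlonglongrightarrow> norm (Gamma (Complex X y))"
    by (intro tendsto_intros)
  have lim': "Gamma_series X \<longlonglongrightarrow> Gamma X" by (intro tendsto_intros)
  show "norm (Gamma (Complex X y)) \<le> Gamma X"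
  proof (rule LIMSEQ_le[OF lim lim'], intro exI allI impI)
    fix n :: nat
    have "(\<Prod>j\<le>n. X + real j) \<le> (\<Prod>j\<le>n. norm (Complex (X + real j) y))"
      using X complex_Re_le_cmod[of "Complex _ y"] by (intro prod_mono) auto
    then have "norm (Gamma_series (Complex X y) n) * (\<Prod>j\<le>n. X + real j) \<le> Gamma_series X n * (\<Prod>j\<le>n. X + real j)"
      using norm_ser[of n] by (metis mult_left_mono norm_ge_zero)
    moreover have "(\<Prod>j\<le>n. X + real j) > 0" using X by (auto intro!: prod_pos add_pos_nonneg)
    ultimately show "norm (Gamma_series (Complex X y) n) \<le> Gamma_series X n" by simp
  qed
  show "Gamma X * exp (- y\<^sup>2) \<le> norm (Gamma (Complex X y))"
  proof (rule LIMSEQ_le[OF tendsto_mult_right[OF lim'] lim], intro exI allI impI)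
    fix n :: nat
    \<comment> \<open>From 1 + t^2 \<le> exp (t^2) with t = y / (X + j); \<open>X \<ge> 1\<close>
      makes the exponent independent of \<open>X\<close>.\<close>
    have le: "norm (Complex (X + real j) y) \<le> (X + real j) * exp (y\<^sup>2 / (2 * (real j + 1)\<^sup>2))" for j
    proof -
      have Xj: "X + real j \<ge> real j + 1" using X by simp
      have "(norm (Complex (X + real j) y))\<^sup>2 = (X + real j)\<^sup>2 * (1 + (y / (X + real j))\<^sup>2)"
        using X by (simp add: cmod_power2 field_simps)
      also have "\<dots> \<le> (X + real j)\<^sup>2 * exp ((y / (X + real j))\<^sup>2)"
        by (intro mult_left_mono) auto
      also have "\<dots> \<le> (X + real j)\<^sup>2 * exp (y\<^sup>2 / (real j + 1)\<^sup>2)"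
        using Xj by (auto simp: power_divide intro!: mult_left_mono divide_left_mono power_mono)
      also have "\<dots> = ((X + real j) * exp (y\<^sup>2 / (2 * (real j + 1)\<^sup>2)))\<^sup>2"
        by (simp add: power_mult_distrib exp_double[symmetric])
      finally show ?thesis by (rule power2_le_imp_le) (use X in auto)
    qed
    \<comment> \<open>The subtracted 1/(n+1) makes the induction close: 1/(n+2)^2 is below the
      telescoping difference 1/(n+1) - 1/(n+2).\<close>
    have sum_le: "(\<Sum>j\<le>n. 1 / (real j + 1)\<^sup>2) \<le> 2 - 1 / (real n + 1)" for n
    proof (induction n)
      case (Suc n)
      have "1 / (real (Suc n) + 1)\<^sup>2 \<le> 1 / (real n + 1) - 1 / (real (Suc n) + 1)"
      proof -
        have "1 / (real (Suc n) + 1)\<^sup>2 \<le> 1 / ((real n + 1) * (real (Suc n) + 1))"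
          unfolding power2_eq_square by (intro divide_left_mono mult_right_mono) auto
        also have "\<dots> = 1 / (real n + 1) - 1 / (real (Suc n) + 1)"
          by (simp add: diff_frac_eq)
        finally show ?thesis .
      qed
      with Suc show ?case by simp
    qed simp
    have "(\<Sum>j\<le>n. y\<^sup>2 / (2 * (real j + 1)\<^sup>2)) = y\<^sup>2 / 2 * (\<Sum>j\<le>n. 1 / (real j + 1)\<^sup>2)"
      by (simp add: sum_distrib_left)
    also have "\<dots> \<le> y\<^sup>2 / 2 * 2"
      by (intro mult_left_mono order.trans[OF sum_le]) auto
    finally have S: "(\<Sum>j\<le>n. y\<^sup>2 / (2 * (real j + 1)\<^sup>2)) \<le> y\<^sup>2" by simp
    have "(\<Prod>j\<le>n. norm (Complex (X + real j) y)) \<le> (\<Prod>j\<le>n. (X + real j) * exp (y\<^sup>2 / (2 * (real j + 1)\<^sup>2)))"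
      using le by (intro prod_mono) auto
    also have "\<dots> = (\<Prod>j\<le>n. X + real j) * exp (\<Sum>j\<le>n. y\<^sup>2 / (2 * (real j + 1)\<^sup>2))"
      by (simp add: prod.distrib exp_sum)
    also have "\<dots> \<le> (\<Prod>j\<le>n. X + real j) * exp (y\<^sup>2)"
      using S X by (intro mult_left_mono) (auto intro!: prod_nonneg)
    finally have "Gamma_series X n * (\<Prod>j\<le>n. X + real j) \<le> norm (Gamma_series (Complex X y) n) * ((\<Prod>j\<le>n. X + real j) * exp (y\<^sup>2))"
      using norm_ser[of n] by (metis mult_left_mono norm_ge_zero)
    moreover have "(\<Prod>j\<le>n. X + real j) > 0" using X by (auto intro!: prod_pos add_pos_nonneg)
    ultimately have "Gamma_series X n \<le> norm (Gamma_series (Complex X y) n) * exp (y\<^sup>2)"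
      by (simp add: mult_ac)
    then show "Gamma_series X n * exp (- y\<^sup>2) \<le> norm (Gamma_series (Complex X y) n)"
      by (simp add: exp_minus divide_simps)
  qed
qed

text \<open>The first bound follows from |sin z|^2 = sin (Re z)^2 + sinh (Im z)^2. It keeps the sine
  away from 0 on a whole horizontal line off the real axis.\<close>

lemma norm_sin_bounds:
  "\<bar>sinh (Im z)\<bar> \<le> norm (sin z)" "norm (sin z) \<le> exp \<bar>Im z\<bar>"
proof -
  have "norm (sin z) ^ 2 = (sin (Re z))\<^sup>2 + (sinh (Im z))\<^sup>2"
  proof -
    have "Re (sin z) = sin (Re z) * cosh (Im z)" "Im (sin z) = cos (Re z) * sinh (Im z)"
      by (simp_all add: Re_sin Im_sin cosh_def sinh_def)
    then have "norm (sin z) ^ 2 = (sin (Re z))\<^sup>2 * (cosh (Im z))\<^sup>2 + (cos (Re z))\<^sup>2 * (sinh (Im z))\<^sup>2"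
      by (simp add: cmod_power2 power_mult_distrib)
    also have "\<dots> = (sin (Re z))\<^sup>2 * (1 + (sinh (Im z))\<^sup>2) + (1 - (sin (Re z))\<^sup>2) * (sinh (Im z))\<^sup>2"
      by (simp add: cosh_square_eq cos_squared_eq)
    finally show ?thesis by (simp add: algebra_simps)
  qed
  then have "\<bar>sinh (Im z)\<bar> ^ 2 \<le> norm (sin z) ^ 2" by simp
  then show "\<bar>sinh (Im z)\<bar> \<le> norm (sin z)" by (rule power2_le_imp_le) simp
  have "norm (sin z) \<le> (norm (exp (\<i> * z)) + norm (exp (-(\<i> * z)))) / 2"
    unfolding sin_exp_eq using norm_triangle_ineq4[of "exp (\<i> * z)" "exp (-(\<i> * z))"]
    by (simp add: norm_divide norm_mult)
  also have "\<dots> = (exp (- Im z) + exp (Im z)) / 2" by simp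
  also have "\<dots> \<le> (exp \<bar>Im z\<bar> + exp \<bar>Im z\<bar>) / 2"
    by (intro divide_right_mono add_mono) auto
  also have "\<dots> = exp \<bar>Im z\<bar>" by simp
  finally show "norm (sin z) \<le> exp \<bar>Im z\<bar>" .
qed

section \<open>The Gamma quotient on horizontal lines towards minus infinity\<close>

text \<open>The Mellin symbol of the kernel: \<open>fox_integrand\<close> without its power of
  \<open>z\<close>.\<close>

definition gamma_quot ::
  "nat \<Rightarrow> (nat \<Rightarrow> real) \<Rightarrow> (nat \<Rightarrow> real) \<Rightarrow> (nat \<Rightarrow> real) \<Rightarrow> (nat \<Rightarrow> real) \<Rightarrow> complex \<Rightarrow> complex"
  where
  "gamma_quot m a A b B s =
     (\<Prod>k=1..m. Gamma (of_real (B k) * s + of_real (b k)) / Gamma (of_real (A k) * s + of_real (a k)))"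

text \<open>Reflection gives |Gamma(w)| = pi / (|sin (pi w)| |Gamma(1 - w)|), and Re (1 - w) =
  \<open>B * x + (1 - b)\<close> is eventually at least 1, where \<open>norm_Gamma_bounds\<close>
  applies. The distance \<open>d\<close> from the real axis, which carries the poles, bounds the
  sine from below by \<open>sinh (pi * (B * d))\<close>.\<close>

lemma norm_Gamma_left_le:
  fixes B b d M :: real
  assumes B: "B > 0" and d: "d > 0"
  shows "\<exists>C>0. eventually (\<lambda>x. \<forall>y. d \<le> \<bar>y\<bar> \<and> \<bar>y\<bar> \<le> M \<longrightarrow>
           norm (Gamma (of_real B * Complex (- x) y + of_real b)) \<le> C * exp (- ln_Gamma (B * x + (1 - b)))) at_top"
proof (intro exI conjI)
  define C where "C = pi / (sinh (pi * (B * d)) * exp (- (B * M)\<^sup>2))"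
  have sp: "sinh (pi * (B * d)) > 0" using B d by simp
  show "C > 0" unfolding C_def using sp by auto
  have "eventually (\<lambda>x. B * x + (1 - b) \<ge> 1) at_top" using B by real_asymp
  then show "eventually (\<lambda>x. \<forall>y. d \<le> \<bar>y\<bar> \<and> \<bar>y\<bar> \<le> M \<longrightarrow>
           norm (Gamma (of_real B * Complex (- x) y + of_real b)) \<le> C * exp (- ln_Gamma (B * x + (1 - b)))) at_top"
  proof (eventually_elim, intro allI impI)
    fix x y assume X: "B * x + (1 - b) \<ge> 1" and y: "d \<le> \<bar>y\<bar> \<and> \<bar>y\<bar> \<le> M"
    define X where "X = B * x + (1 - b)"
    define w where "w = of_real B * Complex (- x) y + of_real b"
    have w1: "1 - w = Complex X (- (B * y))" by (simp add: w_def X_def complex_eq_iff)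
    have Imw: "Im (of_real pi * w) = pi * (B * y)" by (simp add: w_def)
    have "sinh (pi * (B * d)) \<le> sinh (pi * (B * \<bar>y\<bar>))" using B y by simp
    also have "\<dots> = \<bar>sinh (pi * (B * y))\<bar>" using B by (simp add: abs_mult flip: sinh_real_abs)
    also have "\<dots> \<le> norm (sin (of_real pi * w))" using norm_sin_bounds(1)[of "of_real pi * w"] Imw by simp
    finally have S: "sinh (pi * (B * d)) \<le> norm (sin (of_real pi * w))" .
    have "(B * y)\<^sup>2 \<le> (B * M)\<^sup>2"
      using B y by (auto simp: power_mult_distrib simp flip: abs_le_square_iff)
    then have "Gamma X * exp (- (B * M)\<^sup>2) \<le> Gamma X * exp (- (- (B * y))\<^sup>2)"
      using X by (intro mult_left_mono) (auto simp: X_def)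
    also have "\<dots> \<le> norm (Gamma (1 - w))"
      unfolding w1 using norm_Gamma_bounds(2)[of X "- (B * y)"] X by (simp add: X_def)
    finally have G: "Gamma X * exp (- (B * M)\<^sup>2) \<le> norm (Gamma (1 - w))" .
    have Gp: "Gamma X > 0" using X by (simp add: X_def)
    have "norm (Gamma w) * norm (Gamma (1 - w)) = pi / norm (sin (of_real pi * w))"
      using Gamma_reflection_complex[of w] by (simp add: norm_divide flip: norm_mult)
    moreover have Gw: "norm (Gamma (1 - w)) > 0"
      using G Gp by (metis exp_gt_zero mult_pos_pos order.strict_trans2)
    ultimately have "norm (Gamma w) = pi / norm (sin (of_real pi * w)) / norm (Gamma (1 - w))"
      by (metis nonzero_mult_div_cancel_right less_irrefl)
    then have "norm (Gamma w) = pi / (norm (sin (of_real pi * w)) * norm (Gamma (1 - w)))"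
      by (simp only: divide_divide_eq_left)
    also have "\<dots> \<le> pi / (sinh (pi * (B * d)) * (Gamma X * exp (- (B * M)\<^sup>2)))"
      using sp Gp Gw by (intro divide_left_mono mult_mono S G mult_pos_pos order.strict_trans2[OF sp S]) auto
    also have "\<dots> = C * exp (- ln_Gamma X)"
    proof -
      have "Gamma X = exp (ln_Gamma X)" using X by (simp add: Gamma_real_pos_exp X_def)
      then show ?thesis by (simp only: C_def exp_minus) (simp add: divide_inverse mult_ac)
    qed
    finally show "norm (Gamma (of_real B * Complex (- x) y + of_real b)) \<le> C * exp (- ln_Gamma (B * x + (1 - b)))"
      by (simp add: w_def X_def)
  qed
qed

text \<open>The same reflection, now with upper bounds for the sine and for Gamma(1 - w). As 1/Gamma
  is entire, the estimate extends to the real axis.\<close>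

lemma norm_inverse_Gamma_left_le:
  fixes A a M :: real
  assumes A: "A > 0"
  shows "\<exists>C>0. eventually (\<lambda>x. \<forall>y. \<bar>y\<bar> \<le> M \<longrightarrow>
           norm (inverse (Gamma (of_real A * Complex (- x) y + of_real a))) \<le> C * exp (ln_Gamma (A * x + (1 - a)))) at_top"
proof (intro exI conjI)
  define C where "C = exp (pi * (A * M)) / pi"
  show "C > 0" by (simp add: C_def)
  have "eventually (\<lambda>x. A * x + (1 - a) \<ge> 1) at_top" using A by real_asymp
  then show "eventually (\<lambda>x. \<forall>y. \<bar>y\<bar> \<le> M \<longrightarrow>
           norm (inverse (Gamma (of_real A * Complex (- x) y + of_real a))) \<le> C * exp (ln_Gamma (A * x + (1 - a)))) at_top"
  proof (eventually_elim, intro allI impI)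
    fix x y assume X: "A * x + (1 - a) \<ge> 1" and y: "\<bar>y\<bar> \<le> M"
    define X where "X = A * x + (1 - a)"
    define w where "w = of_real A * Complex (- x) y + of_real a"
    have w1: "1 - w = Complex X (- (A * y))" by (simp add: w_def X_def complex_eq_iff)
    have Imw: "\<bar>Im (of_real pi * w)\<bar> = pi * (A * \<bar>y\<bar>)" using A by (simp add: w_def abs_mult)
    have "norm (sin (of_real pi * w)) \<le> exp (pi * (A * \<bar>y\<bar>))"
      using norm_sin_bounds(2)[of "of_real pi * w"] Imw by simp
    also have "\<dots> \<le> exp (pi * (A * M))" using y A by simp
    finally have S: "norm (sin (of_real pi * w)) \<le> exp (pi * (A * M))" .
    have G: "norm (Gamma (1 - w)) \<le> Gamma X"
      unfolding w1 using norm_Gamma_bounds(1)[of X "- (A * y)"] X by (simp add: X_def)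
    have "1 - w \<notin> \<int>\<^sub>\<le>\<^sub>0"
    proof
      assume "1 - w \<in> \<int>\<^sub>\<le>\<^sub>0"
      then obtain n where "1 - w = - of_nat n" by (elim nonpos_Ints_cases')
      then have "Re (1 - w) \<le> 0" by simp
      then show False using X by (simp add: w1 X_def)
    qed
    then have nz: "Gamma (1 - w) \<noteq> 0" by (simp add: Gamma_eq_zero_iff)
    \<comment> \<open>\<open>rGamma\<close> is the entire function 1/Gamma, so this form of the
      reflection formula covers the poles of Gamma, where \<open>Gamma w\<close> and its inverse are
      both 0 by convention.\<close>
    have "rGamma w = sin (of_real pi * w) / of_real pi * Gamma (1 - w)"
    proof -
      have "rGamma w = rGamma w * (rGamma (1 - w) * Gamma (1 - w))"
        using nz by (simp add: rGamma_inverse_Gamma)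
      also have "\<dots> = (rGamma w * rGamma (1 - w)) * Gamma (1 - w)" by (simp only: mult.assoc)
      finally show ?thesis by (simp only: rGamma_reflection_complex)
    qed
    then have "norm (inverse (Gamma w)) = norm (sin (of_real pi * w)) / pi * norm (Gamma (1 - w))"
      by (simp add: norm_mult norm_divide flip: rGamma_inverse_Gamma)
    also have "\<dots> \<le> exp (pi * (A * M)) / pi * Gamma X"
      by (intro mult_mono divide_right_mono S G) auto
    also have "\<dots> = C * exp (ln_Gamma X)"
      using X by (simp add: C_def Gamma_real_pos_exp X_def)
    finally show "norm (inverse (Gamma (of_real A * Complex (- x) y + of_real a))) \<le> C * exp (ln_Gamma (A * x + (1 - a)))"
      by (simp add: w_def X_def)
  qed
qed

text \<open>Each factor is at most a constant times \<open>exp (P k x)\<close>, and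
  \<open>P k x\<close> equals \<open>E k x\<close> up to O(1). Summed over \<open>k\<close>, the
  parts \<open>(A k - B k) * (x * ln x - x)\<close> cancel by \<open>AB\<close>, the parts
  \<open>A k * ln (A k) - B k * ln (B k)\<close> give minus the logarithm of the radius, and
  \<open>ln x\<close> keeps the coefficients \<open>b k - a k\<close>.\<close>

lemma norm_gamma_quot_left_le:
  fixes a b A B :: "nat \<Rightarrow> real"
  assumes A: "\<And>k. k \<in> {1..m} \<Longrightarrow> A k > 0" and B: "\<And>k. k \<in> {1..m} \<Longrightarrow> B k > 0"
    and AB: "(\<Sum>k=1..m. A k) = (\<Sum>k=1..m. B k)" and d: "d > 0"
  shows "\<exists>C. eventually (\<lambda>x. \<forall>y. d \<le> \<bar>y\<bar> \<and> \<bar>y\<bar> \<le> M \<longrightarrow>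
           norm (gamma_quot m a A b B (Complex (- x) y)) \<le>
             C * fox_radius m A B powr (- x) * x powr (\<Sum>k=1..m. b k - a k)) at_top"
proof -
  define P where "P = (\<lambda>k x. ln_Gamma (A k * x + (1 - a k)) - ln_Gamma (B k * x + (1 - b k)))"
  \<comment> \<open>The Stirling main terms of the two logarithms in \<open>P\<close>, with
    \<open>c = 1 - a k\<close> and \<open>c = 1 - b k\<close>; the 1/2 in the coefficients of
    \<open>ln x\<close> cancels in the difference.\<close>
  define E where "E = (\<lambda>k x. (A k * x * ln (A k) + A k * x * ln x + (1/2 - a k) * ln x - A k * x)
                     - (B k * x * ln (B k) + B k * x * ln x + (1/2 - b k) * ln x - B k * x))"
  have "\<forall>k\<in>{1..m}. \<exists>C>0. eventually (\<lambda>x. \<forall>y. d \<le> \<bar>y\<bar> \<and> \<bar>y\<bar> \<le> M \<longrightarrow>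
           norm (Gamma (of_real (B k) * Complex (- x) y + of_real (b k)) / Gamma (of_real (A k) * Complex (- x) y + of_real (a k)))
             \<le> C * exp (P k x)) at_top"
  proof
    fix k assume k: "k \<in> {1..m}"
    obtain C1 where C1: "C1 > 0" "eventually (\<lambda>x. \<forall>y. d \<le> \<bar>y\<bar> \<and> \<bar>y\<bar> \<le> M \<longrightarrow>
           norm (Gamma (of_real (B k) * Complex (- x) y + of_real (b k))) \<le> C1 * exp (- ln_Gamma (B k * x + (1 - b k)))) at_top"
      using norm_Gamma_left_le[OF B[OF k] d] by blast
    obtain C2 where C2: "C2 > 0" "eventually (\<lambda>x. \<forall>y. \<bar>y\<bar> \<le> M \<longrightarrow>
           norm (inverse (Gamma (of_real (A k) * Complex (- x) y + of_real (a k)))) \<le> C2 * exp (ln_Gamma (A k * x + (1 - a k)))) at_top"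
      using norm_inverse_Gamma_left_le[OF A[OF k]] by blast
    show "\<exists>C>0. eventually (\<lambda>x. \<forall>y. d \<le> \<bar>y\<bar> \<and> \<bar>y\<bar> \<le> M \<longrightarrow>
           norm (Gamma (of_real (B k) * Complex (- x) y + of_real (b k)) / Gamma (of_real (A k) * Complex (- x) y + of_real (a k)))
             \<le> C * exp (P k x)) at_top"
    proof (intro exI conjI)
      show "C1 * C2 > 0" using C1(1) C2(1) by simp
      show "eventually (\<lambda>x. \<forall>y. d \<le> \<bar>y\<bar> \<and> \<bar>y\<bar> \<le> M \<longrightarrow>
           norm (Gamma (of_real (B k) * Complex (- x) y + of_real (b k)) / Gamma (of_real (A k) * Complex (- x) y + of_real (a k)))
             \<le> C1 * C2 * exp (P k x)) at_top"
        using C1(2) C2(2)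
      proof (eventually_elim, intro allI impI)
        fix x y
        assume elim: "\<forall>y. d \<le> \<bar>y\<bar> \<and> \<bar>y\<bar> \<le> M \<longrightarrow>
           norm (Gamma (of_real (B k) * Complex (- x) y + of_real (b k))) \<le> C1 * exp (- ln_Gamma (B k * x + (1 - b k)))"
          "\<forall>y. \<bar>y\<bar> \<le> M \<longrightarrow>
           norm (inverse (Gamma (of_real (A k) * Complex (- x) y + of_real (a k)))) \<le> C2 * exp (ln_Gamma (A k * x + (1 - a k)))"
          and y: "d \<le> \<bar>y\<bar> \<and> \<bar>y\<bar> \<le> M"
        have "norm (Gamma (of_real (B k) * Complex (- x) y + of_real (b k))) * norm (inverse (Gamma (of_real (A k) * Complex (- x) y + of_real (a k))))
          \<le> (C1 * exp (- ln_Gamma (B k * x + (1 - b k)))) * (C2 * exp (ln_Gamma (A k * x + (1 - a k))))"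
          using elim y C1(1) by (intro mult_mono) auto
        then show "norm (Gamma (of_real (B k) * Complex (- x) y + of_real (b k)) / Gamma (of_real (A k) * Complex (- x) y + of_real (a k)))
             \<le> C1 * C2 * exp (P k x)"
          by (simp add: P_def divide_inverse norm_mult exp_diff exp_minus mult_ac)
      qed
    qed
  qed
  then obtain C where C: "\<And>k. k \<in> {1..m} \<Longrightarrow> C k > 0"
    "\<And>k. k \<in> {1..m} \<Longrightarrow> eventually (\<lambda>x. \<forall>y. d \<le> \<bar>y\<bar> \<and> \<bar>y\<bar> \<le> M \<longrightarrow>
           norm (Gamma (of_real (B k) * Complex (- x) y + of_real (b k)) / Gamma (of_real (A k) * Complex (- x) y + of_real (a k)))
             \<le> C k * exp (P k x)) at_top"
    unfolding bchoice_iff by blast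
  have "(\<lambda>x. P k x - E k x) \<in> O(\<lambda>_. 1)" if k: "k \<in> {1..m}" for k
    using sum_in_bigo(2)[OF ln_Gamma_affine_asymp[OF A[OF k], of "1 - a k"] ln_Gamma_affine_asymp[OF B[OF k], of "1 - b k"]]
    by (simp add: P_def E_def algebra_simps)
  then have "(\<lambda>x. \<Sum>k=1..m. (P k x - E k x)) \<in> O(\<lambda>_. 1)"
    by (intro big_sum_in_bigo) auto
  then obtain K where K: "eventually (\<lambda>x. \<bar>\<Sum>k=1..m. (P k x - E k x)\<bar> \<le> K) at_top"
    unfolding bigo_def by auto
  have Rpos: "fox_radius m A B > 0"
    unfolding fox_radius_def using A B by (intro mult_pos_pos prod_pos) force+
  have lnR: "ln (fox_radius m A B) = (\<Sum>k=1..m. B k * ln (B k) - A k * ln (A k))"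
  proof -
    have nz: "A k \<noteq> 0" "B k \<noteq> 0" if "k \<in> {1..m}" for k using A[OF that] B[OF that] by auto
    have "ln (\<Prod>k=1..m. A k powr (- A k)) = (\<Sum>k=1..m. ln (A k powr (- A k)))"
      "ln (\<Prod>k=1..m. B k powr B k) = (\<Sum>k=1..m. ln (B k powr B k))"
      using nz by (intro ln_prod; force)+
    moreover have "(\<Prod>k=1..m. A k powr (- A k)) > 0" "(\<Prod>k=1..m. B k powr B k) > 0"
      using nz by (intro prod_pos; force)+
    ultimately show ?thesis
      using nz by (simp add: fox_radius_def ln_mult_pos ln_powr sum_subtractf sum_negf)
  qed
  have sumE: "(\<Sum>k=1..m. E k x) = - x * ln (fox_radius m A B) + (\<Sum>k=1..m. b k - a k) * ln x" for x
  proof -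
    have "(\<Sum>k=1..m. E k x) = (\<Sum>k=1..m. - x * (B k * ln (B k) - A k * ln (A k)) + (b k - a k) * ln x + (x * ln x - x) * (A k - B k))"
      by (intro sum.cong) (auto simp: E_def algebra_simps)
    also have "\<dots> = - x * ln (fox_radius m A B) + (\<Sum>k=1..m. b k - a k) * ln x + (x * ln x - x) * (\<Sum>k=1..m. A k - B k)"
      by (simp only: sum.distrib lnR sum_distrib_left sum_distrib_right)
    finally show ?thesis using AB by (simp add: sum_subtractf)
  qed
  have "eventually (\<lambda>x. \<forall>k\<in>{1..m}. \<forall>y. d \<le> \<bar>y\<bar> \<and> \<bar>y\<bar> \<le> M \<longrightarrow>
           norm (Gamma (of_real (B k) * Complex (- x) y + of_real (b k)) / Gamma (of_real (A k) * Complex (- x) y + of_real (a k)))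
             \<le> C k * exp (P k x)) at_top"
    using C(2) by (intro eventually_ball_finite) auto
  then have "eventually (\<lambda>x. \<forall>y. d \<le> \<bar>y\<bar> \<and> \<bar>y\<bar> \<le> M \<longrightarrow>
           norm (gamma_quot m a A b B (Complex (- x) y)) \<le>
             ((\<Prod>k=1..m. C k) * exp K) * fox_radius m A B powr (- x) * x powr (\<Sum>k=1..m. b k - a k)) at_top"
    using K eventually_gt_at_top[of 0]
  proof (eventually_elim, intro allI impI)
    fix x y
    assume elim: "\<forall>k\<in>{1..m}. \<forall>y. d \<le> \<bar>y\<bar> \<and> \<bar>y\<bar> \<le> M \<longrightarrow>
           norm (Gamma (of_real (B k) * Complex (- x) y + of_real (b k)) / Gamma (of_real (A k) * Complex (- x) y + of_real (a k)))
             \<le> C k * exp (P k x)" "\<bar>\<Sum>k=1..m. (P k x - E k x)\<bar> \<le> K" "0 < x"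
      and y: "d \<le> \<bar>y\<bar> \<and> \<bar>y\<bar> \<le> M"
    have "norm (gamma_quot m a A b B (Complex (- x) y)) \<le> (\<Prod>k=1..m. C k * exp (P k x))"
      unfolding gamma_quot_def prod_norm[symmetric] using elim y by (intro prod_mono) auto
    also have "\<dots> = (\<Prod>k=1..m. C k) * exp (\<Sum>k=1..m. P k x)"
      by (simp add: prod.distrib exp_sum)
    also have "\<dots> \<le> (\<Prod>k=1..m. C k) * exp (K + (\<Sum>k=1..m. E k x))"
      using elim(2) prod_pos[of "{1..m}" C] C(1)
      by (intro mult_left_mono) (auto simp: sum_subtractf intro: less_imp_le)
    also have "\<dots> = ((\<Prod>k=1..m. C k) * exp K) * fox_radius m A B powr (- x) * x powr (\<Sum>k=1..m. b k - a k)"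
    proof -
      have "fox_radius m A B powr (- x) = exp (- x * ln (fox_radius m A B))"
        "x powr (\<Sum>k=1..m. b k - a k) = exp ((\<Sum>k=1..m. b k - a k) * ln x)"
        using elim Rpos by (auto simp: powr_def)
      then show ?thesis unfolding sumE by (simp only: exp_add mult.assoc)
    qed
    finally show "norm (gamma_quot m a A b B (Complex (- x) y)) \<le>
        ((\<Prod>k=1..m. C k) * exp K) * fox_radius m A B powr (- x) * x powr (\<Sum>k=1..m. b k - a k)" .
  qed
  then show ?thesis by blast
qed

section \<open>Left loops\<close>

lemma contour_integral_linepath_same_Im:
  assumes "a < b"
  shows "contour_integral (linepath (Complex a y) (Complex b y)) f = integral {a..b} (\<lambda>x. f (Complex x y))"
proof -
  have "contour_integral (linepath (Complex a y) (Complex b y)) f =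
      (Complex b y - Complex a y) * integral {0..1} (\<lambda>x. f (linepath (Complex a y) (Complex b y) x))"
    by (simp add: contour_integral_integral)
  also have "Complex b y - Complex a y = of_real b - of_real a" by (simp add: complex_eq_iff)
  also have "(\<lambda>x. f (linepath (Complex a y) (Complex b y) x)) = (\<lambda>x. f (linepath (of_real a) (of_real b) x + \<i> * of_real y))"
  proof -
    have "linepath (Complex a y) (Complex b y) x = linepath (of_real a) (of_real b) x + \<i> * of_real y" for x
      by (simp add: linepath_def complex_eq_iff algebra_simps)
    then show ?thesis by simp
  qed
  also have "(of_real b - of_real a) * integral {0..1} (\<lambda>x. f (linepath (of_real a) (of_real b) x + \<i> * of_real y)) =
      contour_integral (linepath (of_real a) (of_real b)) (\<lambda>w. f (w + \<i> * of_real y))"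
    by (simp add: contour_integral_integral)
  also have "\<dots> = integral {a..b} (\<lambda>x. f (Complex x y))"
    using assms by (subst contour_integral_linepath_Reals_eq) (auto simp: Complex_eq)
  finally show ?thesis .
qed

lemma closed_up_loop_path [simp]:
  assumes "valid_path g"
  shows "valid_path (closed_up_loop g T)" "pathfinish (closed_up_loop g T) = pathstart (closed_up_loop g T)"
  using assms by (auto simp: closed_up_loop_def Let_def intro!: valid_path_join)

lemma path_image_closed_up_loop:
  assumes "Re (pathstart g) \<ge> - T" "Re (pathfinish g) \<ge> - T"
  shows "path_image (closed_up_loop g T) =
    {z. Im z = Im (pathstart g) \<and> - T \<le> Re z \<and> Re z \<le> Re (pathstart g)} \<union> path_image g \<union>
    {z. Im z = Im (pathfinish g) \<and> - T \<le> Re z \<and> Re z \<le> Re (pathfinish g)} \<union>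
    {z. Re z = - T \<and> Im z \<in> closed_segment (Im (pathstart g)) (Im (pathfinish g))}"
proof -
  have 1: "closed_segment (Complex (- T) (Im p)) p = {z. Im z = Im p \<and> - T \<le> Re z \<and> Re z \<le> Re p}"
    if "Re p \<ge> - T" for p
    using that by (subst closed_segment_same_Im) (auto simp: closed_segment_eq_real_ivl)
  show ?thesis
    using 1[OF assms(1)] 1[OF assms(2)]
    by (simp add: closed_up_loop_def Let_def path_image_join closed_segment_commute[of "pathfinish g"]
         closed_segment_same_Re Un_assoc)
       (auto simp: closed_segment_commute)
qed

lemma bounded_Re_path_image:
  assumes "valid_path g"
  obtains T where "\<And>z. z \<in> path_image g \<Longrightarrow> - T < Re z"
proof -
  have "bounded (path_image g)" using assms by (simp add: bounded_valid_path_image)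
  then obtain B where B: "\<And>z. z \<in> path_image g \<Longrightarrow> norm z \<le> B" by (auto simp: bounded_iff)
  have "- (B + 1) < Re z" if "z \<in> path_image g" for z
    using B[OF that] abs_Re_le_cmod[of z] by linarith
  then show ?thesis using that by blast
qed

text \<open>Moving the cut from \<open>- T\<close> to \<open>- T'\<close> adds the boundary of a
  rectangle inside the half-plane Re \<le> -T. That half-plane is convex and omits \<open>p\<close>,
  so the winding number does not change.\<close>

lemma winding_number_closed_up_loop:
  assumes g: "valid_path g" and T: "\<And>z. z \<in> path_image g \<Longrightarrow> - T < Re z" and TT: "T \<le> T'"
    and p: "p \<notin> path_image (closed_up_loop g T')" "Re p > - T"
  shows "p \<notin> path_image (closed_up_loop g T)"
    and "winding_number (closed_up_loop g T) p = winding_number (closed_up_loop g T') p"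
proof -
  define s f where "s = pathstart g" and "f = pathfinish g"
  have sf: "- T < Re s" "- T < Re f" using T by (auto simp: s_def f_def)
  note im = path_image_closed_up_loop[of T g] path_image_closed_up_loop[of T' g]
  show notin: "p \<notin> path_image (closed_up_loop g T)"
    using p TT sf im by (auto simp: s_def f_def)
  define low up low' up' where "low = Complex (- T) (Im s)" and "up = Complex (- T) (Im f)"
    and "low' = Complex (- T') (Im s)" and "up' = Complex (- T') (Im f)"
  let ?W = "\<lambda>a b. winding_number (linepath a b) p"
  have cT: "closed_up_loop g T = linepath low s +++ g +++ linepath f up +++ linepath up low"
    "closed_up_loop g T' = linepath low' s +++ g +++ linepath f up' +++ linepath up' low'"
    by (simp_all add: closed_up_loop_def s_def f_def low_def up_def low'_def up'_def Let_def)
  have ends: "pathstart g = s" "pathfinish g = f" by (simp_all add: s_def f_def)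
  have n: "p \<notin> closed_segment low s" "p \<notin> path_image g" "p \<notin> closed_segment f up" "p \<notin> closed_segment up low"
    using notin unfolding cT(1) by (simp_all add: path_image_join ends)
  have n': "p \<notin> closed_segment low' s" "p \<notin> closed_segment f up'" "p \<notin> closed_segment up' low'"
    using p(1) unfolding cT(2) by (simp_all add: path_image_join ends)
  have W: "winding_number (closed_up_loop g T) p = ?W low s + winding_number g p + ?W f up + ?W up low"
    unfolding cT using n g by (simp add: winding_number_join path_image_join ends valid_path_imp_path)
  have W': "winding_number (closed_up_loop g T') p = ?W low' s + winding_number g p + ?W f up' + ?W up' low'"
    unfolding cT using n n' g by (simp add: winding_number_join path_image_join ends valid_path_imp_path)
  have "low \<in> closed_segment low' s"
    using sf TT by (subst closed_segment_same_Im) (auto simp: low_def low'_def closed_segment_eq_real_ivl)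
  then have 1: "?W low' s = ?W low' low + ?W low s" "closed_segment low' low \<subseteq> closed_segment low' s"
    using n' by (auto simp: winding_number_split_linepath subset_closed_segment)
  have "up \<in> closed_segment f up'"
    using sf TT by (subst closed_segment_same_Im) (auto simp: up_def up'_def closed_segment_eq_real_ivl)
  then have 2: "?W f up' = ?W f up + ?W up up'" "closed_segment up up' \<subseteq> closed_segment f up'"
    using n' by (auto simp: winding_number_split_linepath subset_closed_segment)
  have 3: "?W low up = - ?W up low"
    using n winding_number_reversepath[of "linepath up low" p] by simp
  \<comment> \<open>The rectangle between the cuts. Its side from \<open>low\<close> to
    \<open>up\<close> runs against the closing segment of the nearer cut, so its winding number is
    the difference of the other two.\<close>
  define r where "r = linepath low' low +++ linepath low up +++ linepath up up' +++ linepath up' low'"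
  have "winding_number r p = ?W low' low + ?W low up + ?W up up' + ?W up' low'"
    unfolding r_def using n n' 1(2) 2(2)
    by (subst winding_number_join | force simp: path_image_join closed_segment_commute)+
  moreover have "winding_number r p = 0"
  proof (rule winding_number_zero_outside)
    show "convex {z. Re z \<le> - T}" by (rule convex_halfspace_Re_le)
    show "path_image r \<subseteq> {z. Re z \<le> - T}"
      unfolding r_def using TT
      by (simp add: path_image_join closed_segment_subset convex_halfspace_Re_le low_def low'_def up_def up'_def)
  qed (use p(2) in \<open>auto simp: r_def\<close>)
  ultimately show "winding_number (closed_up_loop g T) p = winding_number (closed_up_loop g T') p"
    using W W' 1(1) 2(1) 3 by algebra
qed

text \<open>\<open>left_loop\<close> speaks of distant cuts only, whereas the residue theorem is
  applied to one given cut. Points right of the cut inherit the value 1; a point left of it is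
  separated from the closed-up loop by the half-plane Re \<ge> -T.\<close>

lemma left_loop_winding_number:
  assumes g: "left_loop g P" and T: "\<And>z. z \<in> path_image g \<Longrightarrow> - T < Re z"
    and p: "p \<in> P" "Re p \<noteq> - T"
  shows "p \<notin> path_image (closed_up_loop g T)"
    and "winding_number (closed_up_loop g T) p = (if Re p > - T then 1 else 0)"
proof -
  have vg: "valid_path g" using g by (simp add: left_loop_def)
  have "eventually (\<lambda>T. p \<notin> path_image (closed_up_loop g T) \<and>
                           winding_number (closed_up_loop g T) p = 1) at_top"
    using g p by (auto simp: left_loop_def)
  then have "eventually (\<lambda>T'. T' \<ge> T \<and> p \<notin> path_image (closed_up_loop g T') \<and>
                           winding_number (closed_up_loop g T') p = 1) at_top"
    using eventually_ge_at_top[of T] by eventually_elim auto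
  then obtain T' where T': "T' \<ge> T" "p \<notin> path_image (closed_up_loop g T')" "winding_number (closed_up_loop g T') p = 1"
    by (metis (mono_tags, lifting) eventually_at_top_linorder order_refl)
  have sf: "- T < Re (pathstart g)" "- T < Re (pathfinish g)" using T by auto
  have sub: "path_image (closed_up_loop g T) \<subseteq> {z. Re z \<ge> - T}"
    using sf T by (subst path_image_closed_up_loop) (auto intro: less_imp_le)
  show "p \<notin> path_image (closed_up_loop g T)"
    using winding_number_closed_up_loop(1)[OF vg T T'(1,2)] sub p(2) by force
  show "winding_number (closed_up_loop g T) p = (if Re p > - T then 1 else 0)"
  proof (cases "Re p > - T")
    case True
    then show ?thesis using winding_number_closed_up_loop(2)[OF vg T T'(1,2)] T' by simp
  next
    case False
    then have "winding_number (closed_up_loop g T) p = 0"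
      using p vg sub by (intro winding_number_zero_outside[OF _ convex_halfspace_Re_ge _ _ sub])
        (auto simp: valid_path_imp_path)
    then show ?thesis using False by simp
  qed
qed

text \<open>Puts the rays off the real axis, where the Gamma quotient can be estimated. A pole to
  the left of the whole path \<open>g\<close>, but right of the cut, has at most the two rays above
  or below it.\<close>

lemma left_loop_heights:
  assumes g: "left_loop g P" and P: "\<And>p. p \<in> P \<Longrightarrow> Im p = 0"
    and inf: "\<And>T. \<exists>p\<in>P. Re p < - T"
  shows "Im (pathstart g) < 0" "Im (pathfinish g) > 0"
proof -
  have vg: "valid_path g" and lt: "Im (pathstart g) < Im (pathfinish g)" using g by (simp_all add: left_loop_def)
  obtain T0 where T0: "\<And>z. z \<in> path_image g \<Longrightarrow> - T0 < Re z" using bounded_Re_path_image[OF vg] by blast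
  obtain p where p: "p \<in> P" "Re p < - T0" using inf by blast
  \<comment> \<open>The cut is one unit to the left of \<open>p\<close>, and \<open>p\<close> is to
    the left of \<open>g\<close>; so the vertical line through \<open>p\<close> meets the closed-up
    loop on its rays only.\<close>
  define T where "T = 1 - Re p"
  have T: "- T < Re z" if "z \<in> path_image g" for z using T0[OF that] p by (simp add: T_def)
  have sf: "- T < Re (pathstart g)" "- T < Re (pathfinish g)" using T by auto
  note im = path_image_closed_up_loop[of T g]
  have pT: "Re p > - T" by (simp add: T_def)
  have w: "p \<notin> path_image (closed_up_loop g T)" "winding_number (closed_up_loop g T) p = 1"
    using left_loop_winding_number[OF g T p(1)] pT by auto
  text \<open>If both rays were on one side of the pole, a vertical half-line would lead from it to infinity.\<close>
  have False if h: "\<And>y. y \<ge> 0 \<Longrightarrow> Complex (Re p) (\<sigma> * y) \<notin> path_image (closed_up_loop g T)" and s: "\<bar>\<sigma>\<bar> = 1" for \<sigma>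
  proof -
    define S where "S = (\<lambda>y. Complex (Re p) (\<sigma> * y)) ` {0..}"
    have "connected S" unfolding S_def Complex_eq
      by (intro connected_continuous_image continuous_intros) auto
    moreover have "S \<inter> path_image (closed_up_loop g T) = {}" using h by (auto simp: S_def)
    ultimately have c: "winding_number (closed_up_loop g T) constant_on S"
      by (intro winding_number_constant) (use vg in \<open>auto simp: valid_path_imp_path\<close>)
    obtain B where B: "\<And>z. B \<le> norm z \<Longrightarrow> winding_number (closed_up_loop g T) z = 0"
      using winding_number_zero_at_infinity[of "closed_up_loop g T"] vg by (auto simp: valid_path_imp_path)
    have "norm (Complex (Re p) (\<sigma> * \<bar>B\<bar>)) \<ge> B"
      using abs_Im_le_cmod[of "Complex (Re p) (\<sigma> * \<bar>B\<bar>)"] s by (simp add: abs_mult)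
    then have "winding_number (closed_up_loop g T) (Complex (Re p) (\<sigma> * \<bar>B\<bar>)) = 0" by (rule B)
    moreover have "Complex (Re p) (\<sigma> * \<bar>B\<bar>) \<in> S" "Complex (Re p) (\<sigma> * 0) \<in> S" by (auto simp: S_def)
    moreover have "Complex (Re p) (\<sigma> * 0) = p" using P[OF p(1)] by (simp add: complex_eq_iff)
    ultimately show False using w c unfolding constant_on_def by (metis zero_neq_one)
  qed
  note F = this
  have nog: "Complex (Re p) y \<notin> path_image g" for y using T0[of "Complex (Re p) y"] p by auto
  have nz: "Im (pathstart g) \<noteq> 0" "Im (pathfinish g) \<noteq> 0"
    using w(1) P[OF p(1)] im sf T0[OF pathstart_in_path_image] T0[OF pathfinish_in_path_image] p pT by auto
  \<comment> \<open>If the start lay above the axis, so would the end, and the half-line down from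
    \<open>p\<close> would miss the loop. The other case is the mirror image.\<close>
  show "Im (pathstart g) < 0"
    using F[of "-1"] nog im sf lt nz by (force simp: T_def)
  show "Im (pathfinish g) > 0"
    using F[of "1"] nog im sf lt nz by (force simp: T_def)
qed

lemma contour_integral_closed_up_loop:
  assumes vg: "valid_path g" and F: "F holomorphic_on S" "open S"
    and T: "\<And>z. z \<in> path_image g \<Longrightarrow> - T < Re z"
    and sub: "path_image (closed_up_loop g T) \<subseteq> S"
  shows "contour_integral (closed_up_loop g T) F =
     integral {- T..Re (pathstart g)} (\<lambda>x. F (Complex x (Im (pathstart g)))) + contour_integral g F
     - integral {- T..Re (pathfinish g)} (\<lambda>x. F (Complex x (Im (pathfinish g))))
     + contour_integral (linepath (Complex (- T) (Im (pathfinish g))) (Complex (- T) (Im (pathstart g)))) F"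
proof -
  define s f where "s = pathstart g" and "f = pathfinish g"
  have sf: "- T < Re s" "- T < Re f" using T by (auto simp: s_def f_def)
  define low up where "low = Complex (- T) (Im s)" and "up = Complex (- T) (Im f)"
  have ends: "pathstart g = s" "pathfinish g = f" by (simp_all add: s_def f_def)
  have cT: "closed_up_loop g T = linepath low s +++ g +++ linepath f up +++ linepath up low"
    by (simp_all add: closed_up_loop_def s_def f_def low_def up_def Let_def)
  have n: "closed_segment low s \<subseteq> S" "path_image g \<subseteq> S" "closed_segment f up \<subseteq> S" "closed_segment up low \<subseteq> S"
    using sub unfolding cT(1) by (simp_all add: path_image_join ends)
  have i: "F contour_integrable_on linepath low s" "F contour_integrable_on g"
    "F contour_integrable_on linepath f up" "F contour_integrable_on linepath up low"
    using n vg by (auto intro!: contour_integrable_holomorphic_simple[OF F])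
  have "contour_integral (closed_up_loop g T) F = contour_integral (linepath low s) F + contour_integral g F
     + contour_integral (linepath f up) F + contour_integral (linepath up low) F"
    unfolding cT using i vg by (simp add: ends contour_integrable_joinI)
  moreover have "contour_integral (linepath f up) F = - contour_integral (linepath up f) F"
    using contour_integral_reversepath[of "linepath up f" F] by simp
  moreover have "contour_integral (linepath low s) F = integral {- T..Re s} (\<lambda>x. F (Complex x (Im s)))"
    using contour_integral_linepath_same_Im[of "- T" "Re s" "Im s" F] sf by (simp add: low_def)
  moreover have "contour_integral (linepath up f) F = integral {- T..Re f} (\<lambda>x. F (Complex x (Im f)))"
    using contour_integral_linepath_same_Im[of "- T" "Re f" "Im f" F] sf by (simp add: up_def)
  ultimately show ?thesis by (simp add: s_def f_def low_def up_def)
qed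

text \<open>The closing segments of two loops with equal ray heights coincide, so they cancel and \<open>F\<close> need not
  be estimated between the poles.\<close>

lemma loop_integral_eq:
  assumes g: "left_loop g P" and h: "left_loop h P"
    and ends: "Im (pathstart h) = Im (pathstart g)" "Im (pathfinish h) = Im (pathfinish g)"
    and fin: "\<And>T. finite {p \<in> P. Re p > - T}" and clP: "closed P"
    and F: "F holomorphic_on - P"
    and int: "\<And>x0. set_integrable lborel {..x0} (\<lambda>x. F (Complex x (Im (pathstart g))))"
      "\<And>x0. set_integrable lborel {..x0} (\<lambda>x. F (Complex x (Im (pathfinish g))))"
  shows "loop_integral g F = loop_integral h F"
proof -
  \<comment> \<open>The integral over the closed-up loop without its closing segment; as the cut
    recedes, it tends to \<open>loop_integral\<close>.\<close>
  define J where "J = (\<lambda>g T. integral {- T..Re (pathstart g)} (\<lambda>x. F (Complex x (Im (pathstart g)))) + contour_integral g F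
     - integral {- T..Re (pathfinish g)} (\<lambda>x. F (Complex x (Im (pathfinish g)))))"
  have lim1: "((\<lambda>T. integral {- T..x0} (\<lambda>x. F (Complex x y))) \<longlongrightarrow> (LINT x:{..x0}|lborel. F (Complex x y))) at_top"
    if "set_integrable lborel {..x0} (\<lambda>x. F (Complex x y))" for x0 y
  proof -
    have "((\<lambda>a. set_lebesgue_integral lborel {a..x0} (\<lambda>x. F (Complex x y))) \<longlongrightarrow> (LINT x:{..x0}|lborel. F (Complex x y))) at_bot"
      by (rule tendsto_set_lebesgue_integral_at_bot) (use that in auto)
    moreover have "set_lebesgue_integral lborel {a..x0} (\<lambda>x. F (Complex x y)) = integral {a..x0} (\<lambda>x. F (Complex x y))" for a
      by (intro set_borel_integral_eq_integral set_integrable_subset[OF that]) auto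
    ultimately show ?thesis
      by (auto intro: filterlim_compose filterlim_uminus_at_bot_at_top)
  qed
  have lim: "(J k \<longlongrightarrow> loop_integral k F) at_top"
    if "Im (pathstart k) = Im (pathstart g)" "Im (pathfinish k) = Im (pathfinish g)" for k
    unfolding J_def loop_integral_def using that int by (intro tendsto_intros lim1) auto
  have "((\<lambda>T. J g T - J h T) \<longlongrightarrow> loop_integral g F - loop_integral h F) at_top"
    by (intro tendsto_diff lim) (auto simp: ends)
  have vgh: "valid_path g" "valid_path h" using g h by (simp_all add: left_loop_def)
  obtain T1 where T1: "\<And>z. z \<in> path_image g \<Longrightarrow> - T1 < Re z" using bounded_Re_path_image[OF vgh(1)] by blast
  obtain T2 where T2: "\<And>z. z \<in> path_image h \<Longrightarrow> - T2 < Re z" using bounded_Re_path_image[OF vgh(2)] by blast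
  \<comment> \<open>Equality is obtained for arbitrarily large \<open>T\<close> and not for all,
    since the cut must not pass through a pole. This suffices, because the difference is already
    known to converge.\<close>
  have "\<exists>T>T0. J g T = J h T" for T0
  proof -
    define Tm where "Tm = max T0 (max T1 T2)"
    have "infinite {Tm<..<Tm+1}" by simp
    moreover have "finite ((\<lambda>p. - Re p) ` {p\<in>P. Re p > - (Tm + 1)})" by (rule finite_imageI[OF fin])
    ultimately obtain T where T: "T \<in> {Tm<..<Tm+1}" "T \<notin> (\<lambda>p. - Re p) ` {p\<in>P. Re p > - (Tm + 1)}"
      by (meson finite_subset subsetI)
    have nT: "Re p \<noteq> - T" if "p \<in> P" for p using T that by force
    \<comment> \<open>\<open>S\<close> and \<open>pts\<close> reach one unit beyond the cut, so that
      the loop lies in the open set \<open>S\<close>. Poles between the cut and the edge of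
      \<open>S\<close> have winding number 0 and drop out of the residue sum.\<close>
    define S where "S = {z. Re z > - T - 1}"
    define pts where "pts = {p\<in>P. Re p > - (T + 1)}"
    have C: "contour_integral (closed_up_loop k T) F =
        2 * pi * \<i> * (\<Sum>p\<in>pts. (if Re p > - T then 1 else 0) * residue F p) \<and> path_image (closed_up_loop k T) \<subseteq> - P"
      if k: "left_loop k P" "\<And>z. z \<in> path_image k \<Longrightarrow> - T < Re z" for k
    proof -
      have vk: "valid_path k" using k by (simp add: left_loop_def)
      have sf: "- T < Re (pathstart k)" "- T < Re (pathfinish k)" using k(2) by auto
      note lw = left_loop_winding_number[OF k]
      have sub: "path_image (closed_up_loop k T) \<subseteq> {z. Re z > - T - 1}"
        using sf k(2) by (subst path_image_closed_up_loop) (auto, force)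
      have subP: "path_image (closed_up_loop k T) \<subseteq> - P" using lw(1) nT by blast
      have "contour_integral (closed_up_loop k T) F = 2 * pi * \<i> * (\<Sum>p\<in>pts. winding_number (closed_up_loop k T) p * residue F p)"
      proof (rule Residue_theorem)
        show "open S" "connected S" unfolding S_def
          by (auto intro: open_halfspace_Re_gt convex_connected convex_halfspace_Re_gt)
        show "finite pts" unfolding pts_def by (rule fin)
        show "F holomorphic_on S - pts"
          by (rule holomorphic_on_subset[OF F]) (auto simp: S_def pts_def)
        show "path_image (closed_up_loop k T) \<subseteq> S - pts"
          using sub subP by (auto simp: S_def pts_def)
        show "\<forall>z. z \<notin> S \<longrightarrow> winding_number (closed_up_loop k T) z = 0"
          using sub vk by (auto simp: S_def valid_path_imp_path
             intro!: winding_number_zero_outside[OF _ convex_halfspace_Re_gt _ _ sub])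
      qed (use vk in auto)
      also have "(\<Sum>p\<in>pts. winding_number (closed_up_loop k T) p * residue F p) =
          (\<Sum>p\<in>pts. (if Re p > - T then 1 else 0) * residue F p)"
        using lw(2) nT by (intro sum.cong) (auto simp: pts_def)
      finally show ?thesis using subP by simp
    qed
    have gT: "- T < Re z" if "z \<in> path_image g" for z using T1[OF that] T by (auto simp: Tm_def)
    have hT: "- T < Re z" if "z \<in> path_image h" for z using T2[OF that] T by (auto simp: Tm_def)
    have op: "open (- P)" using clP by (simp add: open_Compl)
    have "J g T = J h T"
      using C[OF g gT] C[OF h hT] contour_integral_closed_up_loop[OF vgh(1) F op gT]
        contour_integral_closed_up_loop[OF vgh(2) F op hT] by (simp add: J_def ends)
    then show ?thesis using T by (auto simp: Tm_def)
  qed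
  then have fr: "frequently (\<lambda>T. J g T - J h T = 0) at_top"
    unfolding frequently_def eventually_at_top_dense by (metis eq_iff_diff_eq_0)
  show ?thesis
  proof (rule ccontr)
    assume "loop_integral g F \<noteq> loop_integral h F"
    then have "loop_integral g F - loop_integral h F \<noteq> 0" by simp
    from tendsto_imp_eventually_ne[OF \<open>((\<lambda>T. J g T - J h T) \<longlongrightarrow> _) at_top\<close> this]
    show False using fr by (simp add: frequently_def)
  qed
qed

section \<open>The kernel\<close>

lemma nn_integral_powr_from_0:
  fixes x \<rho> :: real
  assumes "x > 0" "\<rho> > 0"
  shows "(\<integral>\<^sup>+u. ennreal (u powr (x - 1)) * indicator {0<..<\<rho>} u \<partial>lborel) = ennreal (\<rho> powr x / x)"
proof -
  have "((\<lambda>u. u powr (x - 1)) has_integral (\<rho> powr x / x)) {0..\<rho>}"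
    using has_integral_powr_from_0[of "x - 1" \<rho>] assms by simp
  then have "(\<integral>\<^sup>+u. ennreal (indicator {0..\<rho>} u * u powr (x - 1)) \<partial>lborel) = ennreal (\<rho> powr x / x)"
    by (intro nn_integral_has_integral_lebesgue) auto
  moreover have "(\<integral>\<^sup>+u. ennreal (u powr (x - 1)) * indicator {0<..<\<rho>} u \<partial>lborel) =
      (\<integral>\<^sup>+u. ennreal (indicator {0..\<rho>} u * u powr (x - 1)) \<partial>lborel)"
  proof (rule nn_integral_cong_AE)
    show "AE u in lborel. ennreal (u powr (x - 1)) * indicator {0<..<\<rho>} u = ennreal (indicator {0..\<rho>} u * u powr (x - 1))"
      using AE_lborel_singleton[of 0] AE_lborel_singleton[of \<rho>]
      by eventually_elim (auto simp: indicator_def)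
  qed
  ultimately show ?thesis by simp
qed

text \<open>If \<open>f\<close> is not integrable, its Bochner integral is 0 by convention, so the
  inequality holds in that case as well.\<close>

lemma norm_integral_le_nn_integral:
  fixes f :: "'a \<Rightarrow> 'b::{banach, second_countable_topology}"
  shows "ennreal (norm (integral\<^sup>L M f)) \<le> (\<integral>\<^sup>+x. ennreal (norm (f x)) \<partial>M)"
  by (cases "integrable M f") (auto simp: integral_norm_bound_ennreal not_integrable_integral_eq)

text \<open>One statement for the rays and the vertical side: \<open>z\<close> parametrizes the side
  and \<open>g\<close> is the Gamma quotient along it. Tonelli puts the integral in \<open>u\<close>
  first; that of u^(-Re z - 1) over (0,\<rho>) is \<rho>^(-Re z) / (-Re z), finite because Re z <
  0.\<close>

lemma mellin_piece:
  fixes g z :: "real \<Rightarrow> complex"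
  assumes [measurable]: "g \<in> borel_measurable borel" "z \<in> borel_measurable borel" "S \<in> sets borel"
    and z: "\<And>t. t \<in> S \<Longrightarrow> Re (z t) < 0" and \<rho>: "\<rho> > 0"
    and fin: "(\<integral>\<^sup>+t. ennreal (norm (g t) * (\<rho> powr (- Re (z t)) / (- Re (z t)))) * indicator S t \<partial>lborel) < \<infinity>"
  defines "\<Psi> \<equiv> \<lambda>u. LINT t:S|lborel. g t * exp (- z t * of_real (ln u))"
  shows "\<Psi> \<in> borel_measurable borel"
    and "(\<integral>\<^sup>+u. ennreal (norm (\<Psi> u) / u) * indicator {0<..<\<rho>} u \<partial>lborel) < \<infinity>"
proof -
  show [measurable]: "\<Psi> \<in> borel_measurable borel"
    unfolding \<Psi>_def set_lebesgue_integral_def by measurable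
  have "(\<integral>\<^sup>+u. ennreal (norm (\<Psi> u) / u) * indicator {0<..<\<rho>} u \<partial>lborel) \<le>
     (\<integral>\<^sup>+u. (\<integral>\<^sup>+t. ennreal (norm (g t) * u powr (- Re (z t) - 1)) * indicator S t * indicator {0<..<\<rho>} u \<partial>lborel) \<partial>lborel)"
  proof (rule nn_integral_mono)
    fix u :: real
    show "ennreal (norm (\<Psi> u) / u) * indicator {0<..<\<rho>} u \<le>
      (\<integral>\<^sup>+t. ennreal (norm (g t) * u powr (- Re (z t) - 1)) * indicator S t * indicator {0<..<\<rho>} u \<partial>lborel)"
    proof (cases "u \<in> {0<..<\<rho>}")
      case True
      then have u: "u > 0" by simp
      have "ennreal (norm (\<Psi> u)) \<le> (\<integral>\<^sup>+t. norm (indicator S t *\<^sub>R (g t * exp (- z t * of_real (ln u)))) \<partial>lborel)"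
        unfolding \<Psi>_def set_lebesgue_integral_def by (rule norm_integral_le_nn_integral)
      also have "\<dots> = (\<integral>\<^sup>+t. ennreal (norm (g t) * u powr (- Re (z t))) * indicator S t \<partial>lborel)"
        using u by (intro nn_integral_cong) (auto simp: indicator_def norm_mult powr_def)
      finally have "ennreal (norm (\<Psi> u)) * ennreal (1 / u) \<le>
          (\<integral>\<^sup>+t. ennreal (norm (g t) * u powr (- Re (z t))) * indicator S t \<partial>lborel) * ennreal (1 / u)"
        by (rule mult_right_mono) simp
      also have "\<dots> = (\<integral>\<^sup>+t. ennreal (norm (g t) * u powr (- Re (z t))) * indicator S t * ennreal (1 / u) \<partial>lborel)"
        by (rule nn_integral_multc[symmetric]) measurable
      also have "\<dots> = (\<integral>\<^sup>+t. ennreal (norm (g t) * u powr (- Re (z t) - 1)) * indicator S t * indicator {0<..<\<rho>} u \<partial>lborel)"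
        using u True by (intro nn_integral_cong) (auto simp: indicator_def powr_diff simp flip: ennreal_mult')
      finally show ?thesis using u True by (simp add: divide_inverse flip: ennreal_mult')
    qed simp
  qed
  also have "\<dots> = (\<integral>\<^sup>+t. (\<integral>\<^sup>+u. ennreal (norm (g t) * u powr (- Re (z t) - 1)) * indicator S t * indicator {0<..<\<rho>} u \<partial>lborel) \<partial>lborel)"
    by (rule lborel_pair.Fubini'[symmetric]) measurable
  also have "\<dots> = (\<integral>\<^sup>+t. ennreal (norm (g t) * (\<rho> powr (- Re (z t)) / (- Re (z t)))) * indicator S t \<partial>lborel)"
  proof (rule nn_integral_cong)
    fix t :: real
    show "(\<integral>\<^sup>+u. ennreal (norm (g t) * u powr (- Re (z t) - 1)) * indicator S t * indicator {0<..<\<rho>} u \<partial>lborel)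
      = ennreal (norm (g t) * (\<rho> powr (- Re (z t)) / (- Re (z t)))) * indicator S t"
    proof (cases "t \<in> S")
      case True
      have "(\<integral>\<^sup>+u. ennreal (norm (g t) * u powr (- Re (z t) - 1)) * indicator {0<..<\<rho>} u \<partial>lborel) =
        (\<integral>\<^sup>+u. ennreal (norm (g t)) * (ennreal (u powr (- Re (z t) - 1)) * indicator {0<..<\<rho>} u) \<partial>lborel)"
        by (simp add: ennreal_mult mult.assoc)
      also have "\<dots> = ennreal (norm (g t)) * ennreal (\<rho> powr (- Re (z t)) / (- Re (z t)))"
        using z[OF True] \<rho> by (subst nn_integral_cmult) (auto simp del: minus_divide_right
            simp add: nn_integral_powr_from_0)
      finally show ?thesis using True z[OF True] by (simp flip: ennreal_mult')
    qed simp
  qed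
  finally show "(\<integral>\<^sup>+u. ennreal (norm (\<Psi> u) / u) * indicator {0<..<\<rho>} u \<partial>lborel) < \<infinity>"
    using fin by (rule order.strict_trans1)
qed

lemma set_integrable_powr_left_ray:
  fixes q :: real
  assumes "0 < q" "q < 1"
  shows "set_integrable lborel {..-1} (\<lambda>x. q powr (- x))"
proof -
  have "((\<lambda>x. exp (- (- ln q) * x)) has_integral exp (- (- ln q) * 1) / (- ln q)) {1..}"
    using assms by (intro has_integral_exp_minus_to_infinity) auto
  then have "(\<integral>\<^sup>+x. ennreal (indicator {1..} x * exp (- (- ln q) * x)) \<partial>lborel) = ennreal (exp (- (- ln q) * 1) / (- ln q))"
    by (intro nn_integral_has_integral_lebesgue) auto
  then have "integrable lborel (\<lambda>x. indicator {1..} x * exp (- (- ln q) * x))"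
    by (intro integrableI_nonneg) auto
  from lborel_integrable_real_affine[OF this, of "-1" 0]
  have "integrable lborel (\<lambda>x. indicator {1..} (- x) * exp (- (ln q * x)))" by simp
  then show ?thesis unfolding set_integrable_def
    by (rule back_subst[of "integrable lborel"]) (use assms in \<open>auto simp: fun_eq_iff indicator_def powr_def\<close>)
qed

lemma nn_integral_powr_left_ray:
  fixes D c :: real
  assumes "D > 0" "c > 0"
  shows "(\<integral>\<^sup>+x. ennreal ((- x) powr (- D - 1)) * indicator {..-c} x \<partial>lborel) < \<infinity>"
proof -
  have "((\<lambda>x. x powr (- D - 1)) has_integral -(c powr (- D - 1 + 1)) / (- D - 1 + 1)) {c..}"
    using assms by (intro has_integral_powr_to_inf) auto
  then have *: "(\<integral>\<^sup>+x. ennreal (indicator {c..} x * x powr (- D - 1)) \<partial>lborel) = ennreal (-(c powr (- D - 1 + 1)) / (- D - 1 + 1))"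
    by (intro nn_integral_has_integral_lebesgue) auto
  have "(\<integral>\<^sup>+x. ennreal ((- x) powr (- D - 1)) * indicator {..-c} x \<partial>lborel) =
    (\<integral>\<^sup>+x. ennreal ((- (- x)) powr (- D - 1)) * indicator {..-c} (- x) \<partial>lborel)"
    using nn_integral_real_affine[of "\<lambda>x. ennreal ((- x) powr (- D - 1)) * indicator {..-c} x" "-1" 0] by simp
  also have "\<dots> = (\<integral>\<^sup>+x. ennreal (indicator {c..} x * x powr (- D - 1)) \<partial>lborel)"
    by (intro nn_integral_cong) (auto simp: indicator_def)
  finally show ?thesis using * by simp
qed

section \<open>Poles of the numerator and holomorphy of the quotient\<close>

lemma gamma_poles_cases:
  assumes "p \<in> gamma_poles m (\<lambda>k. of_real (b k)) B" and "\<And>k. k \<in> {1..m} \<Longrightarrow> B k > 0"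
  obtains k n where "k \<in> {1..m}" "p = of_real (- (real n + b k) / B k)"
proof -
  obtain k n where k: "k \<in> {1..m}" "of_real (B k) * p + of_real (b k) = - of_nat n"
    using assms(1) by (auto simp: gamma_poles_def elim!: nonpos_Ints_cases')
  have "of_real (B k) * p = of_real (- (real n + b k))" using k(2) by (simp add: algebra_simps eq_neg_iff_add_eq_0)
  moreover have "B k \<noteq> 0" using assms(2)[OF k(1)] by simp
  ultimately have "p = of_real (- (real n + b k) / B k)"
    by (simp add: field_simps)
  then show ?thesis using that k by blast
qed

lemma finite_gamma_poles:
  assumes B: "\<And>k. k \<in> {1..m} \<Longrightarrow> B k > 0"
  shows "finite {p \<in> gamma_poles m (\<lambda>k. of_real (b k)) B. Re p > - T}"
proof (rule finite_subset)
  show "{p \<in> gamma_poles m (\<lambda>k. of_real (b k)) B. Re p > - T} \<subseteq>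
    (\<Union>k\<in>{1..m}. (\<lambda>n. of_real (- (real n + b k) / B k)) ` {..nat \<lceil>T * B k - b k\<rceil>})"
  proof
    fix p assume "p \<in> {p \<in> gamma_poles m (\<lambda>k. of_real (b k)) B. Re p > - T}"
    then have p: "p \<in> gamma_poles m (\<lambda>k. of_real (b k)) B" "Re p > - T" by auto
    obtain k n where k: "k \<in> {1..m}" "p = of_real (- (real n + b k) / B k)"
      using gamma_poles_cases[OF p(1) B] by blast
    have "- T < - (real n + b k) / B k" using p(2) unfolding k(2) Re_complex_of_real .
    then have "real n < T * B k - b k" using B[OF k(1)] by (simp add: field_simps)
    then have "n \<le> nat \<lceil>T * B k - b k\<rceil>" by linarith
    then show "p \<in> (\<Union>k\<in>{1..m}. (\<lambda>n. of_real (- (real n + b k) / B k)) ` {..nat \<lceil>T * B k - b k\<rceil>})"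
      using k by blast
  qed
qed auto

lemma closed_gamma_poles: "closed (gamma_poles m b B)"
proof -
  have "gamma_poles m b B = (\<Union>k\<in>{1..m}. (\<lambda>s. of_real (B k) * s + b k) -` \<int>\<^sub>\<le>\<^sub>0)"
    by (auto simp: gamma_poles_def)
  also have "closed \<dots>"
    by (intro closed_UN closed_vimage) (auto intro!: continuous_intros)
  finally show ?thesis .
qed

lemma holomorphic_gamma_quot:
  "gamma_quot m a A b B holomorphic_on - gamma_poles m (\<lambda>k. of_real (b k)) B"
proof -
  \<comment> \<open>Written with the entire function \<open>rGamma\<close>, the denominators
    contribute no singularities.\<close>
  have "(\<lambda>s. \<Prod>k=1..m. Gamma (of_real (B k) * s + of_real (b k)) * rGamma (of_real (A k) * s + of_real (a k)))
      holomorphic_on - gamma_poles m (\<lambda>k. of_real (b k)) B"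
    by (intro holomorphic_intros) (auto simp: gamma_poles_def)
  also have "(\<lambda>s. \<Prod>k=1..m. Gamma (of_real (B k) * s + of_real (b k)) * rGamma (of_real (A k) * s + of_real (a k)))
      = gamma_quot m a A b B"
    by (simp add: gamma_quot_def rGamma_inverse_Gamma divide_inverse fun_eq_iff)
  finally show ?thesis .
qed

section \<open>The kernel as a loop integral\<close>

text \<open>Positivity of \<open>b\<close> puts all poles into the open left half-plane. In the
  application it is the condition on the minimum, \<open>AB\<close> is the equality of the sums of
  reciprocals, and \<open>ab\<close> expresses, given \<open>AB\<close>, that the \<delta>_k have a
  positive sum.\<close>

locale fox_kernel =
  fixes m :: nat and a b A B :: "nat \<Rightarrow> real"
  assumes m: "m \<ge> 1"
    and A: "\<And>k. k \<in> {1..m} \<Longrightarrow> A k > 0" and B: "\<And>k. k \<in> {1..m} \<Longrightarrow> B k > 0"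
    and b: "\<And>k. k \<in> {1..m} \<Longrightarrow> b k > 0"
    and AB: "(\<Sum>k=1..m. A k) = (\<Sum>k=1..m. B k)"
    and ab: "(\<Sum>k=1..m. a k - b k) > 0"
begin

abbreviation "P \<equiv> gamma_poles m (\<lambda>k. of_real (b k)) B"
abbreviation "G \<equiv> gamma_quot m a A b B"
abbreviation "R \<equiv> fox_radius m A B"
abbreviation "D \<equiv> (\<Sum>k=1..m. a k - b k)"
abbreviation "F u \<equiv> fox_integrand m (\<lambda>k. of_real (a k)) A (\<lambda>k. of_real (b k)) B (of_real u)"

lemma Rpos: "R > 0"
  unfolding fox_radius_def using A B by (intro mult_pos_pos prod_pos) force+

lemma F_eq:
  assumes "u > 0"
  shows "F u s = G s * exp (- s * of_real (ln u))"
  using assms by (simp add: fox_integrand_def gamma_quot_def powr_def Ln_of_real)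

lemma poles_real: "p \<in> P \<Longrightarrow> Im p = 0"
  by (rule gamma_poles_cases[of p m b B]) (auto intro: B)

lemma poles_left:
  obtains c where "c > 0" "\<And>p. p \<in> P \<Longrightarrow> Re p < - c"
proof -
  \<comment> \<open>The rightmost pole is \<open>- M\<close>; half of \<open>M\<close> makes the
    inequality strict.\<close>
  define M where "M = Min ((\<lambda>k. b k / B k) ` {1..m})"
  have M: "M > 0" unfolding M_def using m b B by (subst Min_gr_iff) auto
  have "Re p < - (M / 2)" if p: "p \<in> P" for p
  proof -
    obtain k n where k: "k \<in> {1..m}" "p = of_real (- (real n + b k) / B k)"
      using gamma_poles_cases[OF p B] by blast
    have "M \<le> b k / B k" unfolding M_def using k(1) by (intro Min_le) auto
    also have "\<dots> \<le> (real n + b k) / B k" using B[OF k(1)] by (intro divide_right_mono) auto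
    finally have "- (real n + b k) / B k \<le> - M" by (simp only: minus_divide_left[symmetric] neg_le_iff_le)
    then show ?thesis using M unfolding k(2) Re_complex_of_real by linarith
  qed
  then show ?thesis using that[of "M / 2"] M by simp
qed

lemma poles_unbounded: "\<exists>p\<in>P. Re p < - T"
proof -
  define n where "n = nat \<lceil>\<bar>T\<bar> * B 1\<rceil>"
  have B1: "B 1 > 0" "b 1 > 0" using B b m by auto
  have "real n \<ge> \<bar>T\<bar> * B 1" unfolding n_def by linarith
  then have "\<bar>T\<bar> * B 1 < real n + b 1" using B1 by linarith
  then have "\<bar>T\<bar> < (real n + b 1) / B 1" using B1 by (simp add: field_simps)
  then have "- ((real n + b 1) / B 1) < - T" by linarith
  then have "Re (of_real (- (real n + b 1) / B 1)) < - T" by (simp only: Re_complex_of_real minus_divide_left[symmetric])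
  moreover have "of_real (- (real n + b 1) / B 1) \<in> P"
    unfolding gamma_poles_def using m B1 by (auto intro!: bexI[of _ 1] simp: field_simps)
  ultimately show ?thesis by blast
qed

lemma continuous_G_horizontal: "y \<noteq> 0 \<Longrightarrow> continuous_on X (\<lambda>x. G (Complex x y))"
  by (rule continuous_on_compose2[OF holomorphic_on_imp_continuous_on[OF holomorphic_gamma_quot]])
     (auto simp: Complex_eq intro!: continuous_intros dest: poles_real)

text \<open>The Stirling estimate holds far to the left only. On the compact rest the ratio of the
  quotient to the comparison function \<open>q\<close> is continuous, hence bounded, since a line
  with \<open>y \<noteq> 0\<close> carries no poles.\<close>

lemma G_bound:
  assumes y: "y \<noteq> 0" and x0: "x0 > 0"
  obtains C where "C > 0" "\<And>x. x \<le> - x0 \<Longrightarrow> norm (G (Complex x y)) \<le> C * (R powr x * (- x) powr (- D))"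
proof -
  \<comment> \<open>The band between \<open>d\<close> and \<open>M\<close> is shrunk to |y'| = |y|
    by taking both bounds equal to |y|.\<close>
  have "\<exists>C. eventually (\<lambda>x. \<forall>y'. \<bar>y\<bar> \<le> \<bar>y'\<bar> \<and> \<bar>y'\<bar> \<le> \<bar>y\<bar> \<longrightarrow>
           norm (G (Complex (- x) y')) \<le> C * R powr (- x) * x powr (\<Sum>k=1..m. b k - a k)) at_top"
    using y by (intro norm_gamma_quot_left_le A B AB) auto
  moreover have "(\<Sum>k=1..m. b k - a k) = - D" by (simp add: sum_subtractf)
  ultimately obtain C1 X where C1: "\<And>x. x \<ge> X \<Longrightarrow> norm (G (Complex (- x) y)) \<le> C1 * R powr (- x) * x powr (- D)"
    unfolding eventually_at_top_linorder by auto
  define q where "q = (\<lambda>x. R powr (- x) * x powr (- D))"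
  have "continuous_on {x0..X} (\<lambda>x. norm (G (Complex (- x) y)) / q x)"
    unfolding q_def using x0 Rpos y
    by (intro continuous_intros continuous_on_compose2[OF continuous_G_horizontal[OF y, of UNIV]]) auto
  then have "bounded ((\<lambda>x. norm (G (Complex (- x) y)) / q x) ` {x0..X})"
    by (intro compact_imp_bounded compact_continuous_image) auto
  then obtain C2 where "\<And>v. v \<in> (\<lambda>x. norm (G (Complex (- x) y)) / q x) ` {x0..X} \<Longrightarrow> norm v \<le> C2"
    unfolding bounded_iff by blast
  then have "norm (norm (G (Complex (- x) y)) / q x) \<le> C2" if "x \<in> {x0..X}" for x
    using that by blast
  then have C2: "norm (G (Complex (- x) y)) / q x \<le> C2" if "x \<in> {x0..X}" for x
    using that unfolding real_norm_def by (meson abs_ge_self order.trans)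
  have "norm (G (Complex x y)) \<le> (\<bar>C1\<bar> + \<bar>C2\<bar> + 1) * (R powr x * (- x) powr (- D))" if x: "x \<le> - x0" for x
  proof -
    have q: "q (- x) > 0" using x x0 Rpos by (simp add: q_def)
    have "norm (G (Complex x y)) \<le> max C1 C2 * q (- x)"
    proof (cases "- x \<ge> X")
      case True
      have "norm (G (Complex x y)) \<le> C1 * q (- x)" using C1[OF True] by (simp add: q_def)
      then show ?thesis using q by (meson max.cobounded1 mult_right_mono less_imp_le order.trans)
    next
      case False
      then have "norm (G (Complex x y)) \<le> C2 * q (- x)" using C2[of "- x"] x q by (simp add: field_simps)
      then show ?thesis using q by (meson max.cobounded2 mult_right_mono less_imp_le order.trans)
    qed
    also have "\<dots> \<le> (\<bar>C1\<bar> + \<bar>C2\<bar> + 1) * q (- x)" using q by (intro mult_right_mono) auto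
    finally show ?thesis by (simp add: q_def)
  qed
  then show ?thesis using that[of "\<bar>C1\<bar> + \<bar>C2\<bar> + 1"] by auto
qed

text \<open>For fixed \<open>u < R\<close> the integrand decays geometrically, like (u/R)^(-x). The
  power of -x is merely bounded by 1 here; its decay matters when \<open>u\<close> is integrated up
  to R.\<close>

lemma F_integrable_ray:
  assumes u: "0 < u" "u < R" and y: "y \<noteq> 0"
  shows "set_integrable lborel {..x0} (\<lambda>x. F u (Complex x y))"
proof -
  have cont: "continuous_on X (\<lambda>x. F u (Complex x y))" for X
    unfolding F_eq[OF u(1)]
    unfolding Complex_eq using continuous_G_horizontal[OF y, of X, unfolded Complex_eq] by (intro continuous_intros)
  obtain C where C: "C > 0" "\<And>x. x \<le> - 1 \<Longrightarrow> norm (G (Complex x y)) \<le> C * (R powr x * (- x) powr (- D))"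
    using G_bound[OF y, of 1] by auto
  have 1: "set_integrable lborel {..-1} (\<lambda>x. F u (Complex x y))"
  proof (rule set_integrable_bound)
    show "set_integrable lborel {..-1} (\<lambda>x. C * (u / R) powr (- x))"
      using u by (intro set_integrable_mult_right set_integrable_powr_left_ray) auto
    show "set_borel_measurable lborel {..- 1} (\<lambda>x. F u (Complex x y))"
      unfolding set_borel_measurable_def using borel_measurable_continuous_onI[OF cont] by simp
    show "AE x in lborel. x \<in> {..- 1} \<longrightarrow> norm (F u (Complex x y)) \<le> norm (C * (u / R) powr (- x))"
    proof (intro AE_I2 impI)
      fix x :: real assume x: "x \<in> {..-1}"
      have "norm (F u (Complex x y)) = norm (G (Complex x y)) * u powr (- x)"
        using u by (simp add: F_eq norm_mult powr_def)
      also have "\<dots> \<le> C * (R powr x * (- x) powr (- D)) * u powr (- x)"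
        using C(2) x by (intro mult_right_mono) auto
      also have "\<dots> \<le> C * (R powr x * 1) * u powr (- x)"
        using C(1) x ab by (intro mult_right_mono mult_left_mono) (auto simp: powr_minus field_simps ge_one_powr_ge_zero)
      also have "\<dots> = C * (u / R) powr (- x)"
        using u Rpos by (simp add: powr_divide powr_minus field_simps)
      finally show "norm (F u (Complex x y)) \<le> norm (C * (u / R) powr (- x))" using C(1) by simp
    qed
  qed
  have 2: "set_integrable lborel {-1..x0} (\<lambda>x. F u (Complex x y))"
    by (rule borel_integrable_atLeastAtMost') (rule cont)
  show ?thesis
    by (rule set_integrable_subset[OF set_integrable_Un[OF 1 2]]) auto
qed

text \<open>The heights \<open>y1\<close> and \<open>y2\<close> are those of the selected loop, of
  which only the signs are known; its bounded part is exchanged for a vertical segment at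
  \<open>- c\<close>, right of all poles. The factor \<i> is the derivative of the upward
  parametrization.\<close>

lemma fox_H_pieces:
  obtains c y1 y2 where "c > 0" "y1 < 0" "y2 > 0" "\<And>p. p \<in> P \<Longrightarrow> Re p < - c"
    "\<And>u. 0 < u \<Longrightarrow> u < R \<Longrightarrow> fox_H m (\<lambda>k. of_real (a k)) A (\<lambda>k. of_real (b k)) B (of_real u) =
      ((LINT x:{..-c}|lborel. G (Complex x y1) * exp (- Complex x y1 * of_real (ln u)))
       + \<i> * (LINT y:{y1..y2}|lborel. G (Complex (-c) y) * exp (- Complex (-c) y * of_real (ln u)))
       - (LINT x:{..-c}|lborel. G (Complex x y2) * exp (- Complex x y2 * of_real (ln u)))) / (2 * of_real pi * \<i>)"
proof -
  define g where "g = (SOME g. left_loop g P)"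
  have g: "left_loop g P" unfolding g_def by (rule someI_ex[of "\<lambda>g. left_loop g P"], rule left_loop_exists, rule B)
  define y1 y2 where "y1 = Im (pathstart g)" and "y2 = Im (pathfinish g)"
  have y: "y1 < 0" "y2 > 0"
    using left_loop_heights[OF g poles_real poles_unbounded] by (auto simp: y1_def y2_def)
  obtain c where c: "c > 0" "\<And>p. p \<in> P \<Longrightarrow> Re p < - c" using poles_left by blast
  define h where "h = linepath (Complex (- c) y1) (Complex (- c) y2)"
  have closed: "closed_up_loop h T = rectpath (Complex (- T) y1) (Complex (- c) y2)" for T
    by (simp add: closed_up_loop_def h_def rectpath_def Let_def)
  have h: "left_loop h P"
    unfolding left_loop_def
  proof (intro conjI ballI)
    fix p assume p: "p \<in> P"
    show "eventually (\<lambda>T. p \<notin> path_image (closed_up_loop h T) \<and> winding_number (closed_up_loop h T) p = 1) at_top"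
      using eventually_gt_at_top[of "- Re p"]
    proof eventually_elim
      case (elim T)
      then have "p \<in> box (Complex (- T) y1) (Complex (- c) y2)"
        using c(2)[OF p] poles_real[OF p] y by (auto simp: in_box_complex_iff)
      moreover have "- T \<le> - c" using elim c(2)[OF p] by simp
      ultimately show ?case
        using y by (auto simp: closed winding_number_rectpath path_image_rectpath_cbox_minus_box)
    qed
  qed (use y in \<open>auto simp: h_def\<close>)
  have "fox_H m (\<lambda>k. of_real (a k)) A (\<lambda>k. of_real (b k)) B (of_real u) =
      ((LINT x:{..-c}|lborel. G (Complex x y1) * exp (- Complex x y1 * of_real (ln u)))
       + \<i> * (LINT y:{y1..y2}|lborel. G (Complex (-c) y) * exp (- Complex (-c) y * of_real (ln u)))
       - (LINT x:{..-c}|lborel. G (Complex x y2) * exp (- Complex x y2 * of_real (ln u)))) / (2 * of_real pi * \<i>)"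
    if u: "0 < u" "u < R" for u
  proof -
    have F: "F u holomorphic_on - P"
      unfolding F_eq[OF u(1), abs_def] by (intro holomorphic_intros holomorphic_gamma_quot)
    have "fox_H m (\<lambda>k. of_real (a k)) A (\<lambda>k. of_real (b k)) B (of_real u) = loop_integral g (F u) / (2 * of_real pi * \<i>)"
      using u by (simp add: fox_H_def g_def)
    also have "loop_integral g (F u) = loop_integral h (F u)"
      using u y by (intro loop_integral_eq[OF g h] finite_gamma_poles B closed_gamma_poles F F_integrable_ray)
        (auto simp: h_def y1_def y2_def)
    also have "\<dots> = (LINT x:{..-c}|lborel. F u (Complex x y1)) + contour_integral h (F u) - (LINT x:{..-c}|lborel. F u (Complex x y2))"
      by (simp add: loop_integral_def h_def)
    also have "contour_integral h (F u) = \<i> * integral {y1..y2} (\<lambda>y. F u (Complex (- c) y))"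
      unfolding h_def using y by (intro contour_integral_linepath_same_Re) auto
    also have "integral {y1..y2} (\<lambda>y. F u (Complex (- c) y)) = (LINT y:{y1..y2}|lborel. F u (Complex (- c) y))"
    proof (rule set_borel_integral_eq_integral(2)[symmetric], rule borel_integrable_atLeastAtMost')
      show "continuous_on {y1..y2} (\<lambda>y. F u (Complex (- c) y))"
        by (rule continuous_on_compose2[OF holomorphic_on_imp_continuous_on[OF F]])
           (auto simp: Complex_eq intro!: continuous_intros dest: c(2))
    qed
    finally show ?thesis unfolding F_eq[OF u(1)] .
  qed
  then show ?thesis using that c y by blast
qed

text \<open>The three sides of the loop are integrated against du/u one at a time. Measurability
  concerns the restriction to the unit interval, where the kernel is either given by the loop
  formula or 0.\<close>

lemma fox_H_measurable_integrable:
  defines "H \<equiv> \<lambda>u. fox_H m (\<lambda>k. of_real (a k)) A (\<lambda>k. of_real (b k)) B (of_real u)"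
  shows "(\<lambda>u. indicator {0<..<1} u *\<^sub>R H u) \<in> borel_measurable borel"
    and "set_integrable lborel {0<..<1} (\<lambda>u. norm (H u) / u)"
proof -
  obtain c y1 y2 where c0: "c > 0" and y: "y1 < 0" "y2 > 0" and c1: "\<And>p. p \<in> P \<Longrightarrow> Re p < - c"
    and H: "\<And>u. 0 < u \<Longrightarrow> u < R \<Longrightarrow> fox_H m (\<lambda>k. of_real (a k)) A (\<lambda>k. of_real (b k)) B (of_real u) =
      ((LINT x:{..-c}|lborel. G (Complex x y1) * exp (- Complex x y1 * of_real (ln u)))
       + \<i> * (LINT y:{y1..y2}|lborel. G (Complex (-c) y) * exp (- Complex (-c) y * of_real (ln u)))
       - (LINT x:{..-c}|lborel. G (Complex x y2) * exp (- Complex x y2 * of_real (ln u)))) / (2 * of_real pi * \<i>)"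
    by (rule fox_H_pieces) blast
  note c = c0 c1
  define \<Psi> where "\<Psi> = (\<lambda>y u. LINT x:{..-c}|lborel. G (Complex x y) * exp (- Complex x y * of_real (ln u)))"
  define V where "V = (\<lambda>u. LINT y:{y1..y2}|lborel. G (Complex (-c) y) * exp (- Complex (-c) y * of_real (ln u)))"
  \<comment> \<open>At most 1, because \<open>u\<close> stays in the unit interval, and at most
    \<open>R\<close>, because the loop formula is available below \<open>R\<close> only.\<close>
  define \<rho> where "\<rho> = min 1 R"
  have \<rho>: "\<rho> > 0" using Rpos by (simp add: \<rho>_def)
  have horiz: "\<Psi> y \<in> borel_measurable borel"
    "(\<integral>\<^sup>+u. ennreal (norm (\<Psi> y u) / u) * indicator {0<..<\<rho>} u \<partial>lborel) < \<infinity>" if y: "y \<noteq> 0" for y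
  proof -
    have m1: "(\<lambda>x. G (Complex x y)) \<in> borel_measurable borel"
      by (rule borel_measurable_continuous_onI[OF continuous_G_horizontal[OF y]])
    have m2: "(\<lambda>x. Complex x y) \<in> borel_measurable borel"
      by (rule borel_measurable_continuous_onI) (auto simp: Complex_eq intro!: continuous_intros)
    obtain C where C: "C > 0" "\<And>x. x \<le> - c \<Longrightarrow> norm (G (Complex x y)) \<le> C * (R powr x * (- x) powr (- D))"
      using G_bound[OF y c(1)] by auto
    have "(\<integral>\<^sup>+x. ennreal (norm (G (Complex x y)) * (\<rho> powr (- Re (Complex x y)) / (- Re (Complex x y)))) * indicator {..-c} x \<partial>lborel)
      \<le> (\<integral>\<^sup>+x. ennreal C * (ennreal ((- x) powr (- D - 1)) * indicator {..-c} x) \<partial>lborel)"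
    proof (rule nn_integral_mono)
      fix x :: real
      have "norm (G (Complex x y)) * (\<rho> powr (- x) / (- x)) \<le> C * (- x) powr (- D - 1)" if x: "x \<le> - c"
      proof -
        have xp: "- x > 0" using x c by simp
        \<comment> \<open>As \<open>- x > 0\<close> and \<rho> \<le> R, the factor \<rho>^(-x) is at
          most R^(-x), which cancels R^x and leaves an integrable power of -x.\<close>
        have "norm (G (Complex x y)) * (\<rho> powr (- x) / (- x)) \<le> C * (R powr x * (- x) powr (- D)) * (R powr (- x) / (- x))"
          using C x xp \<rho> by (intro mult_mono divide_right_mono powr_mono2) (auto simp: \<rho>_def divide_nonneg_neg)
        also have "\<dots> = C * (R powr x * R powr (- x)) * ((- x) powr (- D) / (- x))" by (simp add: divide_inverse mult_ac)
        also have "R powr x * R powr (- x) = 1" using Rpos by (simp add: powr_minus)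
        also have "(- x) powr (- D) / (- x) = (- x) powr (- D - 1)" using xp by (simp add: powr_diff)
        finally show ?thesis by simp
      qed
      then show "ennreal (norm (G (Complex x y)) * (\<rho> powr (- Re (Complex x y)) / (- Re (Complex x y)))) * indicator {..-c} x
          \<le> ennreal C * (ennreal ((- x) powr (- D - 1)) * indicator {..-c} x)"
        using C(1) by (auto simp: indicator_def simp flip: ennreal_mult' intro!: ennreal_leI)
    qed
    also have "\<dots> = ennreal C * (\<integral>\<^sup>+x. ennreal ((- x) powr (- D - 1)) * indicator {..-c} x \<partial>lborel)"
      by (rule nn_integral_cmult) measurable
    also have "\<dots> < \<infinity>" using nn_integral_powr_left_ray[OF ab c(1)] by (simp add: ennreal_mult_less_top)
    finally have fin: "(\<integral>\<^sup>+x. ennreal (norm (G (Complex x y)) * (\<rho> powr (- Re (Complex x y)) / (- Re (Complex x y)))) * indicator {..-c} x \<partial>lborel) < \<infinity>" .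
    show "\<Psi> y \<in> borel_measurable borel"
      "(\<integral>\<^sup>+u. ennreal (norm (\<Psi> y u) / u) * indicator {0<..<\<rho>} u \<partial>lborel) < \<infinity>"
      unfolding \<Psi>_def using c(1) by (intro mellin_piece[OF m1 m2 _ _ \<rho> fin]; auto)+
  qed
  have vert: "V \<in> borel_measurable borel"
    "(\<integral>\<^sup>+u. ennreal (norm (V u) / u) * indicator {0<..<\<rho>} u \<partial>lborel) < \<infinity>"
  proof -
    have cont: "continuous_on X (\<lambda>y. G (Complex (-c) y))" for X
      by (rule continuous_on_compose2[OF holomorphic_on_imp_continuous_on[OF holomorphic_gamma_quot]])
         (auto simp: Complex_eq intro!: continuous_intros dest: c(2))
    have m1: "(\<lambda>y. G (Complex (-c) y)) \<in> borel_measurable borel"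
      by (rule borel_measurable_continuous_onI[OF cont])
    have m2: "(\<lambda>y. Complex (-c) y) \<in> borel_measurable borel"
      by (rule borel_measurable_continuous_onI) (auto simp: Complex_eq intro!: continuous_intros)
    \<comment> \<open>The vertical side is compact and free of poles, so continuity
      suffices.\<close>
    have "set_integrable lborel {y1..y2} (\<lambda>y. norm (G (Complex (-c) y)) * (\<rho> powr c / c))"
      by (rule borel_integrable_atLeastAtMost') (intro continuous_intros cont)
    then have "integrable lborel (\<lambda>y. norm (G (Complex (-c) y)) * (\<rho> powr c / c) * indicator {y1..y2} y)"
      by (simp add: set_integrable_def mult.commute)
    then have "(\<integral>\<^sup>+y. ennreal (norm (norm (G (Complex (-c) y)) * (\<rho> powr c / c) * indicator {y1..y2} y)) \<partial>lborel) < \<infinity>"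
      by (simp add: integrable_iff_bounded)
    also have "(\<integral>\<^sup>+y. ennreal (norm (norm (G (Complex (-c) y)) * (\<rho> powr c / c) * indicator {y1..y2} y)) \<partial>lborel) =
       (\<integral>\<^sup>+y. ennreal (norm (G (Complex (-c) y)) * (\<rho> powr (- Re (Complex (-c) y)) / (- Re (Complex (-c) y)))) * indicator {y1..y2} y \<partial>lborel)"
      using c(1) by (intro nn_integral_cong) (auto simp: indicator_def)
    finally have fin: "(\<integral>\<^sup>+y. ennreal (norm (G (Complex (-c) y)) * (\<rho> powr (- Re (Complex (-c) y)) / (- Re (Complex (-c) y)))) * indicator {y1..y2} y \<partial>lborel) < \<infinity>" .
    show "V \<in> borel_measurable borel"
      "(\<integral>\<^sup>+u. ennreal (norm (V u) / u) * indicator {0<..<\<rho>} u \<partial>lborel) < \<infinity>"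
      unfolding V_def using c(1) by (intro mellin_piece[OF m1 m2 _ _ \<rho> fin]; auto)+
  qed
  have y0: "y1 \<noteq> 0" "y2 \<noteq> 0" using y by auto
  note [measurable] = vert(1) horiz(1)[OF y0(1)] horiz(1)[OF y0(2)]
  have Heq: "H u = (\<Psi> y1 u + \<i> * V u - \<Psi> y2 u) / (2 * of_real pi * \<i>)" if "u \<in> {0<..<\<rho>}" for u
    using H[of u] that by (simp add: H_def \<Psi>_def V_def \<rho>_def)
  \<comment> \<open>Relevant if \<open>R < 1\<close>: from \<open>R\<close> on, \<open>fox_H\<close>
    is 0 by definition.\<close>
  have H0: "H u = 0" if "u \<in> {0<..<1}" "u \<notin> {0<..<\<rho>}" for u
    using that by (auto simp: H_def \<rho>_def fox_H_def)
  have ind: "indicator {0<..<1} u *\<^sub>R H u = indicator {0<..<\<rho>} u *\<^sub>R ((\<Psi> y1 u + \<i> * V u - \<Psi> y2 u) / (2 * of_real pi * \<i>))" for u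
    using Heq[of u] H0[of u] by (auto simp: indicator_def \<rho>_def)
  have "(\<lambda>u. indicator {0<..<\<rho>} u *\<^sub>R ((\<Psi> y1 u + \<i> * V u - \<Psi> y2 u) / (2 * of_real pi * \<i>))) \<in> borel_measurable borel"
    by measurable
  then show meas: "(\<lambda>u. indicator {0<..<1} u *\<^sub>R H u) \<in> borel_measurable borel"
    by (simp only: ind)
  have "(\<integral>\<^sup>+u. ennreal (norm (indicator {0<..<1} u *\<^sub>R (norm (H u) / u))) \<partial>lborel) \<le>
     (\<integral>\<^sup>+u. ennreal (norm (\<Psi> y1 u) / u) * indicator {0<..<\<rho>} u + ennreal (norm (V u) / u) * indicator {0<..<\<rho>} u
        + ennreal (norm (\<Psi> y2 u) / u) * indicator {0<..<\<rho>} u \<partial>lborel)"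
  proof (rule nn_integral_mono)
    fix u :: real
    show "ennreal (norm (indicator {0<..<1} u *\<^sub>R (norm (H u) / u))) \<le>
      ennreal (norm (\<Psi> y1 u) / u) * indicator {0<..<\<rho>} u + ennreal (norm (V u) / u) * indicator {0<..<\<rho>} u
        + ennreal (norm (\<Psi> y2 u) / u) * indicator {0<..<\<rho>} u"
    proof (cases "u \<in> {0<..<\<rho>}")
      case True
      have "norm (\<Psi> y1 u + \<i> * V u - \<Psi> y2 u) \<le> norm (\<Psi> y1 u) + norm (V u) + norm (\<Psi> y2 u)"
        using norm_triangle_ineq4[of "\<Psi> y1 u + \<i> * V u" "\<Psi> y2 u"] norm_triangle_ineq[of "\<Psi> y1 u" "\<i> * V u"]
        by (simp add: norm_mult)
      moreover have "norm (\<Psi> y1 u + \<i> * V u - \<Psi> y2 u) / (2 * pi) \<le> norm (\<Psi> y1 u + \<i> * V u - \<Psi> y2 u) / 1"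
        using pi_gt3 by (intro divide_left_mono) auto
      ultimately have "norm (H u) \<le> norm (\<Psi> y1 u) + norm (V u) + norm (\<Psi> y2 u)"
        unfolding Heq[OF True] by (simp add: norm_divide norm_mult)
      then have "norm (H u) / u \<le> norm (\<Psi> y1 u) / u + norm (V u) / u + norm (\<Psi> y2 u) / u"
        using True by (simp add: field_simps)
      then show ?thesis using True by (auto simp: \<rho>_def simp flip: ennreal_plus intro!: ennreal_leI)
    next
      case False
      then show ?thesis using H0[of u] by (auto simp: indicator_def)
    qed
  qed
  also have "\<dots> = (\<integral>\<^sup>+u. ennreal (norm (\<Psi> y1 u) / u) * indicator {0<..<\<rho>} u \<partial>lborel) +
     (\<integral>\<^sup>+u. ennreal (norm (V u) / u) * indicator {0<..<\<rho>} u \<partial>lborel) +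
     (\<integral>\<^sup>+u. ennreal (norm (\<Psi> y2 u) / u) * indicator {0<..<\<rho>} u \<partial>lborel)"
    by (simp add: nn_integral_add)
  also have "\<dots> < \<infinity>" using vert(2) horiz(2)[OF y0(1)] horiz(2)[OF y0(2)] by simp
  finally have fin: "(\<integral>\<^sup>+u. ennreal (norm (indicator {0<..<1} u *\<^sub>R (norm (H u) / u))) \<partial>lborel) < \<infinity>" .
  have "(\<lambda>u. norm (indicator {0<..<1} u *\<^sub>R H u) / u) \<in> borel_measurable borel"
    using meas by measurable
  also have "(\<lambda>u. norm (indicator {0<..<1} u *\<^sub>R H u) / u) = (\<lambda>u. indicator {0<..<1} u *\<^sub>R (norm (H u) / u))"
    by (auto simp: fun_eq_iff)
  finally show "set_integrable lborel {0<..<1} (\<lambda>u. norm (H u) / u)"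
    unfolding set_integrable_def using fin by (intro integrableI_bounded) auto
qed

end

section \<open>Poisson averages of integrable functions\<close>

lemma schwartz_continuous: "schwartz \<phi> \<Longrightarrow> continuous_on X \<phi>"
  unfolding schwartz_def iter_deriv_def
  by (metis differentiable_imp_continuous_within continuous_at_imp_continuous_on funpow_0)

lemma schwartz_measurable: "schwartz \<phi> \<Longrightarrow> \<phi> \<in> borel_measurable borel"
  by (intro borel_measurable_continuous_onI schwartz_continuous)

lemma schwartz_seminorm_bound:
  assumes "schwartz \<phi>"
  shows "norm (x ^ j *\<^sub>R iter_deriv k \<phi> x) \<le> schwartz_seminorm j k \<phi>"
proof -
  have "bounded (range (\<lambda>x. x ^ j *\<^sub>R iter_deriv k \<phi> x))" using assms by (simp add: schwartz_def)
  then obtain K where "\<And>x. norm (x ^ j *\<^sub>R iter_deriv k \<phi> x) \<le> K"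
    unfolding bounded_iff by blast
  then have "bdd_above (range (\<lambda>x. norm (x ^ j *\<^sub>R iter_deriv k \<phi> x)))"
    by (intro bdd_aboveI[of _ K]) blast
  then show ?thesis unfolding schwartz_seminorm_def by (rule cSUP_upper[rotated]) simp
qed

lemma schwartz_bound: "schwartz \<phi> \<Longrightarrow> norm (\<phi> x) \<le> schwartz_seminorm 0 0 \<phi>"
  using schwartz_seminorm_bound[of \<phi> x 0 0] by (simp add: iter_deriv_def)

lemma schwartz_integrable:
  assumes "schwartz \<phi>"
  shows "integrable lborel \<phi>"
proof (rule Bochner_Integration.integrable_bound)
  define C where "C = schwartz_seminorm 0 0 \<phi> + schwartz_seminorm 2 0 \<phi>"
  have "integrable lborel (\<lambda>x::real. inverse (1 + x\<^sup>2))"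
    using integrable_inverse_1_plus_square by (simp add: set_integrable_def)
  then show "integrable lborel (\<lambda>x::real. C * inverse (1 + x\<^sup>2))" by (rule integrable_mult_right)
  show "AE x in lborel. norm (\<phi> x) \<le> norm (C * inverse (1 + x\<^sup>2))"
  proof (rule AE_I2)
    fix x :: real
    have "x\<^sup>2 * norm (\<phi> x) \<le> schwartz_seminorm 2 0 \<phi>"
      using schwartz_seminorm_bound[OF assms, of x 2 0] by (simp add: iter_deriv_def)
    then have "(1 + x\<^sup>2) * norm (\<phi> x) \<le> C"
      using schwartz_bound[OF assms, of x] by (simp add: C_def algebra_simps)
    moreover have "1 + x\<^sup>2 > 0" by (simp add: add_pos_nonneg)
    ultimately have "norm (\<phi> x) \<le> C * inverse (1 + x\<^sup>2)" by (simp add: field_simps)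
    then show "norm (\<phi> x) \<le> norm (C * inverse (1 + x\<^sup>2))" by simp
  qed
qed (use schwartz_measurable[OF assms] in simp)

lemma poly_le_exp:
  fixes q :: "real poly"
  shows "\<exists>C. \<forall>y. \<bar>poly q y\<bar> \<le> C * exp \<bar>y\<bar>"
proof (intro exI allI)
  fix y :: real
  have pw: "\<bar>y\<bar> ^ n \<le> fact n * exp \<bar>y\<bar>" for n
  proof -
    have "(\<lambda>n. \<bar>y\<bar> ^ n /\<^sub>R fact n) sums exp \<bar>y\<bar>" by (rule exp_converges)
    then have "(\<Sum>i\<in>{n}. \<bar>y\<bar> ^ i /\<^sub>R fact i) \<le> exp \<bar>y\<bar>"
      unfolding sums_iff by (metis (no_types, lifting) sum_le_suminf finite.emptyI finite.insertI
          scaleR_nonneg_nonneg inverse_nonnegative_iff_nonnegative fact_ge_zero zero_le_power abs_ge_zero)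
    then show ?thesis by (simp add: field_simps)
  qed
  have "\<bar>poly q y\<bar> \<le> (\<Sum>i\<le>degree q. \<bar>coeff q i * y ^ i\<bar>)"
    unfolding poly_altdef by (rule sum_abs)
  also have "\<dots> \<le> (\<Sum>i\<le>degree q. \<bar>coeff q i\<bar> * (fact i * exp \<bar>y\<bar>))"
    using pw by (intro sum_mono) (auto simp: abs_mult power_abs intro!: mult_left_mono)
  also have "\<dots> = (\<Sum>i\<le>degree q. \<bar>coeff q i\<bar> * fact i) * exp \<bar>y\<bar>"
    by (simp only: sum_distrib_right mult.assoc)
  finally show "\<bar>poly q y\<bar> \<le> (\<Sum>i\<le>degree q. \<bar>coeff q i\<bar> * fact i) * exp \<bar>y\<bar>" .
qed

text \<open>Polynomial multiples of a Gaussian are closed under differentiation and under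
  multiplication by \<open>x\<close>, so the Schwartz property reduces to boundedness. The constant
  polynomial 1 gives the test functions.\<close>

definition poly_gaussian :: "real \<Rightarrow> real \<Rightarrow> real poly \<Rightarrow> real \<Rightarrow> complex" where
  "poly_gaussian a b q x = of_real (poly q x * exp (- (a * x + b)\<^sup>2))"

text \<open>In the variable y = a x + b the polynomial becomes \<open>r\<close>, which is at most C
  exp |y| in modulus, and |y| - y^2 \<le> 1.\<close>

lemma bounded_poly_gaussian:
  assumes "a \<noteq> 0"
  shows "bounded (range (poly_gaussian a b q))"
proof -
  define r where "r = q \<circ>\<^sub>p [:- b / a, 1 / a:]"
  obtain C where C: "\<And>y. \<bar>poly r y\<bar> \<le> C * exp \<bar>y\<bar>" using poly_le_exp by blast
  have "norm (poly_gaussian a b q x) \<le> C * exp 1" for x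
  proof -
    define y where "y = a * x + b"
    have q: "poly q x = poly r y" using assms by (simp add: r_def y_def poly_pcompose field_simps)
    have C0: "C \<ge> 0" using C[of 0] by simp
    have "0 \<le> (\<bar>y\<bar> - 1)\<^sup>2" "0 \<le> y * y" by simp_all
    moreover from this(1) have "2 * \<bar>y\<bar> \<le> 1 + y * y" by (simp add: power2_eq_square algebra_simps)
    ultimately have "\<bar>y\<bar> - y\<^sup>2 \<le> 1" unfolding power2_eq_square by linarith
    have "norm (poly_gaussian a b q x) = \<bar>poly r y\<bar> * exp (- y\<^sup>2)"
      by (simp only: poly_gaussian_def norm_of_real abs_mult q y_def[symmetric] abs_exp_cancel)
    also have "\<dots> \<le> C * exp \<bar>y\<bar> * exp (- y\<^sup>2)" by (intro mult_right_mono C) simp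
    also have "\<dots> = C * exp (\<bar>y\<bar> - y\<^sup>2)" by (simp add: exp_diff exp_minus field_simps)
    also have "\<dots> \<le> C * exp 1" using C0 \<open>\<bar>y\<bar> - y\<^sup>2 \<le> 1\<close> by (intro mult_left_mono) auto
    finally show ?thesis .
  qed
  then show ?thesis unfolding bounded_iff by blast
qed

lemma poly_gaussian_has_vector_derivative:
  "(poly_gaussian a b q has_vector_derivative
      poly_gaussian a b (pderiv q + q * [:- 2 * a * b, - 2 * a\<^sup>2:]) x) (at x)"
  unfolding poly_gaussian_def
  by (rule has_vector_derivative_of_real)
     (auto intro!: derivative_eq_intros simp: has_real_derivative_iff_has_vector_derivative[symmetric]
        algebra_simps power2_eq_square)

lemma iter_deriv_poly_gaussian: "\<exists>r. iter_deriv k (poly_gaussian a b q) = poly_gaussian a b r"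
proof (induction k)
  case 0
  then show ?case by (auto simp: iter_deriv_def)
next
  case (Suc k)
  then obtain r where "iter_deriv k (poly_gaussian a b q) = poly_gaussian a b r" by blast
  then have "iter_deriv (Suc k) (poly_gaussian a b q) = (\<lambda>x. vector_derivative (poly_gaussian a b r) (at x))"
    by (simp add: iter_deriv_def)
  also have "\<dots> = poly_gaussian a b (pderiv r + r * [:- 2 * a * b, - 2 * a\<^sup>2:])"
    by (intro ext vector_derivative_at poly_gaussian_has_vector_derivative)
  finally show ?case by blast
qed

lemma schwartz_poly_gaussian:
  assumes "a \<noteq> 0"
  shows "schwartz (poly_gaussian a b q)"
  unfolding schwartz_def
proof (intro conjI allI)
  fix k x
  show "iter_deriv k (poly_gaussian a b q) differentiable at x"
    using iter_deriv_poly_gaussian[of k a b q] poly_gaussian_has_vector_derivative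
    by (metis differentiableI_vector)
next
  fix j k
  obtain r where r: "iter_deriv k (poly_gaussian a b q) = poly_gaussian a b r"
    using iter_deriv_poly_gaussian by blast
  have "(\<lambda>x. x ^ j *\<^sub>R poly_gaussian a b r x) = poly_gaussian a b (monom 1 j * r)"
    by (simp add: poly_gaussian_def fun_eq_iff poly_monom scaleR_conv_of_real)
  then show "bounded (range (\<lambda>x. x ^ j *\<^sub>R iter_deriv k (poly_gaussian a b q) x))"
    unfolding r by (simp only: bounded_poly_gaussian[OF assms])
qed

lemma has_bochner_integral_gaussian:
  "has_bochner_integral lborel (\<lambda>x::real. exp (- x\<^sup>2)) (sqrt pi)"
proof -
  note 1 = gaussian_moment_0
  have 2: "has_bochner_integral lborel (\<lambda>x::real. indicator {0..} (- x) *\<^sub>R exp (- x\<^sup>2)) (sqrt pi / 2)"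
    using lborel_has_bochner_integral_real_affine_iff[of "-1" "\<lambda>x. indicator {0..} x *\<^sub>R exp (- x\<^sup>2)" "sqrt pi / 2" 0] 1
    by simp
  have "has_bochner_integral lborel (\<lambda>x::real. indicator {0..} x *\<^sub>R exp (- x\<^sup>2) + indicator {0..} (- x) *\<^sub>R exp (- x\<^sup>2))
     (sqrt pi / 2 + sqrt pi / 2)"
    by (rule has_bochner_integral_add[OF 1 2])
  moreover have "(\<lambda>x::real. indicator {0..} x *\<^sub>R exp (- x\<^sup>2) + indicator {0..} (- x) *\<^sub>R exp (- x\<^sup>2)) \<in> borel_measurable lborel"
    by measurable
  moreover have "AE x in lborel. indicator {0..} x *\<^sub>R exp (- x\<^sup>2) + indicator {0..} (- x) *\<^sub>R exp (- x\<^sup>2) = exp (- x\<^sup>2 :: real)"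
    using AE_lborel_singleton[of 0] by eventually_elim (auto simp: indicator_def)
  ultimately show ?thesis
    by (subst has_bochner_integral_cong_AE[symmetric]) auto
qed

text \<open>The test functions are Gaussians concentrating at a point.\<close>

lemma continuous_bounded_eq_0_if_schwartz_integrals_eq_0:
  fixes d :: "real \<Rightarrow> complex"
  assumes cont: "continuous_on UNIV d" and bd: "bounded (range d)"
    and zero: "\<And>\<phi>. schwartz \<phi> \<Longrightarrow> (LINT y|lborel. d y * \<phi> y) = 0"
  shows "d x = 0"
proof -
  obtain B where B: "\<And>y. norm (d y) \<le> B" using bd by (auto simp: bounded_iff)
  have [measurable]: "d \<in> borel_measurable borel" by (rule borel_measurable_continuous_onI[OF cont])
  \<comment> \<open>The integrand after y = x + v/N with N = n + 1, which turns the Gaussian of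
    width 1/N about \<open>x\<close> into a fixed one. The integrals vanish, and by dominated
    convergence they tend to \<open>d x\<close> times the integral of exp (-v^2).\<close>
  define s where "s = (\<lambda>n v. d (x + v / real (Suc n)) * of_real (exp (- v\<^sup>2)))"
  have s0: "(LINT v|lborel. s n v) = 0" for n
  proof -
    define N where "N = real (Suc n)"
    have N: "N > 0" by (simp add: N_def)
    have "0 = (LINT y|lborel. d y * poly_gaussian N (- N * x) 1 y)"
      using N by (intro zero[symmetric] schwartz_poly_gaussian) auto
    also have "\<dots> = \<bar>1 / N\<bar> *\<^sub>R (LINT v|lborel. d (x + 1 / N * v) * poly_gaussian N (- N * x) 1 (x + 1 / N * v))"
      by (rule lborel_integral_real_affine) (use N in auto)
    also have "(\<lambda>v. d (x + 1 / N * v) * poly_gaussian N (- N * x) 1 (x + 1 / N * v)) = s n"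
    proof
      fix v
      have "N * (x + 1 / N * v) + - N * x = v" "x + 1 / N * v = x + v / N" using N by (simp_all add: field_simps)
      then show "d (x + 1 / N * v) * poly_gaussian N (- N * x) 1 (x + 1 / N * v) = s n v"
        unfolding s_def poly_gaussian_def N_def[symmetric] by (simp only: poly_1 mult_1)
    qed
    finally show ?thesis using N by simp
  qed
  have "(\<lambda>n. LINT v|lborel. s n v) \<longlonglongrightarrow> (LINT v|lborel. d x * of_real (exp (- v\<^sup>2)))"
  proof (rule integral_dominated_convergence)
    show "integrable lborel (\<lambda>v. B * exp (- v\<^sup>2))"
      using has_bochner_integral_gaussian by (auto simp: has_bochner_integral_iff)
    show "AE v in lborel. (\<lambda>n. s n v) \<longlonglongrightarrow> d x * of_real (exp (- v\<^sup>2))"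
    proof (rule AE_I2)
      fix v :: real
      have "(\<lambda>n. x + v / real (Suc n)) \<longlonglongrightarrow> x + 0"
        by (intro tendsto_add tendsto_const LIMSEQ_Suc lim_const_over_n)
      moreover have "isCont d x" using cont by (simp add: continuous_on_eq_continuous_at)
      ultimately have "(\<lambda>n. d (x + v / real (Suc n))) \<longlonglongrightarrow> d x"
        by (intro isCont_tendsto_compose[of x d]) auto
      then show "(\<lambda>n. s n v) \<longlonglongrightarrow> d x * of_real (exp (- v\<^sup>2))" unfolding s_def by (intro tendsto_intros)
    qed
    show "AE v in lborel. norm (s n v) \<le> B * exp (- v\<^sup>2)" for n
      by (auto simp: s_def norm_mult intro!: mult_right_mono B)
  qed (auto simp: s_def)
  then have "(LINT v|lborel. d x * of_real (exp (- v\<^sup>2))) = 0" unfolding s0 by (simp add: LIMSEQ_const_iff)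
  moreover have "(LINT v|lborel. d x * of_real (exp (- v\<^sup>2))) = d x * of_real (sqrt pi)"
  proof -
    have "has_bochner_integral lborel (\<lambda>v::real. complex_of_real (exp (- v\<^sup>2))) (of_real (sqrt pi))"
      by (rule has_bochner_integral_of_real[OF has_bochner_integral_gaussian])
    then show ?thesis by (simp add: has_bochner_integral_iff)
  qed
  ultimately have "d x * of_real (sqrt pi) = 0" by (simp only:)
  then show ?thesis by simp
qed

section \<open>The Poisson kernel and Poisson integrals\<close>

lemma poisson_kernel_nonneg: "t > 0 \<Longrightarrow> poisson_kernel t x \<ge> 0"
  by (simp add: poisson_kernel_def)

lemma poisson_kernel_le: "t > 0 \<Longrightarrow> poisson_kernel t x \<le> 1 / (pi * t)"
  by (simp add: poisson_kernel_def field_simps add_pos_nonneg)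

lemma continuous_poisson_kernel: "t > 0 \<Longrightarrow> continuous_on X (poisson_kernel t)"
  unfolding poisson_kernel_def
  by (intro continuous_intros) (auto simp: add_nonneg_eq_0_iff)

lemma borel_measurable_poisson_kernel [measurable]: "poisson_kernel t \<in> borel_measurable borel"
  unfolding poisson_kernel_def by measurable

lemma integrable_poisson_kernel:
  assumes "t > 0"
  shows "integrable lborel (poisson_kernel t)"
proof -
  have "integrable lborel (\<lambda>x::real. inverse (1 + x\<^sup>2))"
    using integrable_inverse_1_plus_square by (simp add: set_integrable_def)
  then have "integrable lborel (\<lambda>x. inverse (1 + (0 + (1 / t) * x)\<^sup>2))"
    by (rule lborel_integrable_real_affine) (use assms in auto)
  then have "integrable lborel (\<lambda>x. 1 / pi / t * inverse (1 + (0 + (1 / t) * x)\<^sup>2))"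
    by (rule integrable_mult_right)
  then show ?thesis
    by (rule back_subst[of "integrable lborel"]) (auto simp: poisson_kernel_def fun_eq_iff field_simps)
qed

lemma poisson_kernel_dilate:
  assumes "u > 0" "t > 0"
  shows "poisson_kernel t (v / u) = u * poisson_kernel (t * u) v"
proof -
  have "v / u / t = v / (t * u)" by simp
  then show ?thesis unfolding poisson_kernel_def using assms by simp
qed

text \<open>The explicit value of the definite description \<open>poisson_conv\<close> on an
  integrable function.\<close>

definition pconv :: "(real \<Rightarrow> complex) \<Rightarrow> real \<Rightarrow> real \<Rightarrow> complex" where
  "pconv f t x = (LINT z|lborel. f z * of_real (poisson_kernel t (x - z)))"

lemma integrable_mult_bounded:
  fixes f g :: "real \<Rightarrow> complex"
  assumes "integrable lborel f" "g \<in> borel_measurable borel" "\<And>x. norm (g x) \<le> B"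
  shows "integrable lborel (\<lambda>x. f x * g x)"
proof (rule Bochner_Integration.integrable_bound)
  show "integrable lborel (\<lambda>x. B * norm (f x))" using assms(1) by simp
  show "AE x in lborel. norm (f x * g x) \<le> norm (B * norm (f x))"
  proof (rule AE_I2)
    fix x
    have "norm (f x) * norm (g x) \<le> norm (f x) * \<bar>B\<bar>"
      using assms(3)[of x] by (intro mult_left_mono) auto
    then show "norm (f x * g x) \<le> norm (B * norm (f x))" by (simp add: norm_mult abs_mult mult.commute)
  qed
qed (use assms in \<open>auto dest: borel_measurable_integrable\<close>)

lemma integrable_lborel_pair_mult:
  fixes f g :: "real \<Rightarrow> real"
  assumes f: "integrable lborel f" and g: "integrable lborel g"
  shows "integrable (lborel \<Otimes>\<^sub>M lborel) (\<lambda>(x, y). f x * g y)"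
proof (rule lborel_pair.Fubini_integrable)
  show "integrable lborel (\<lambda>x. LINT y|lborel. norm (case (x, y) of (x, y) \<Rightarrow> f x * g y))"
    using f by (simp add: abs_mult)
  show "AE x in lborel. integrable lborel (\<lambda>y. case (x, y) of (x, y) \<Rightarrow> f x * g y)"
    using g by simp
qed (use f g in \<open>auto dest!: borel_measurable_integrable\<close>)

lemma norm_pconv_integrand_le:
  fixes f :: "real \<Rightarrow> complex"
  assumes "t > 0"
  shows "norm (f z * of_real (poisson_kernel t (x - z))) \<le> norm (f z) * (1 / (pi * t))"
  using mult_left_mono[OF poisson_kernel_le[OF assms, of "x - z"], of "norm (f z)"] poisson_kernel_nonneg[OF assms, of "x - z"]
  by (simp add: norm_mult)

lemma continuous_pconv:
  assumes f: "integrable lborel f" and t: "t > 0"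
  shows "continuous_on UNIV (pconv f t)"
proof -
  have [measurable]: "f \<in> borel_measurable borel" using f by (auto dest: borel_measurable_integrable)
  have "(\<lambda>n. pconv f t (X n)) \<longlonglongrightarrow> pconv f t x" if X: "X \<longlonglongrightarrow> x" for X x
    unfolding pconv_def
  proof (rule integral_dominated_convergence)
    show "integrable lborel (\<lambda>z. norm (f z) * (1 / (pi * t)))" using f by simp
    show "AE z in lborel. (\<lambda>n. f z * of_real (poisson_kernel t (X n - z))) \<longlonglongrightarrow> f z * of_real (poisson_kernel t (x - z))"
    proof (rule AE_I2)
      fix z
      have "(\<lambda>n. X n - z) \<longlonglongrightarrow> x - z" by (intro tendsto_intros X)
      moreover have "isCont (poisson_kernel t) (x - z)"
        using continuous_poisson_kernel[OF t, of UNIV] by (simp add: continuous_on_eq_continuous_at)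
      ultimately have "(\<lambda>n. poisson_kernel t (X n - z)) \<longlonglongrightarrow> poisson_kernel t (x - z)"
        by (rule isCont_tendsto_compose[rotated])
      then show "(\<lambda>n. f z * of_real (poisson_kernel t (X n - z))) \<longlonglongrightarrow> f z * of_real (poisson_kernel t (x - z))"
        by (intro tendsto_intros)
    qed
    show "AE z in lborel. norm (f z * of_real (poisson_kernel t (X n - z))) \<le> norm (f z) * (1 / (pi * t))" for n
      using norm_pconv_integrand_le[OF t] by blast
  qed measurable
  then show ?thesis
    by (auto simp: continuous_on_eq_continuous_at continuous_at_sequentially o_def)
qed

lemma bounded_pconv:
  assumes f: "integrable lborel f" and t: "t > 0"
  shows "bounded (range (pconv f t))"
proof -
  have "norm (pconv f t x) \<le> (LINT z|lborel. norm (f z) * (1 / (pi * t)))" for x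
    unfolding pconv_def
  proof (rule Bochner_Integration.integral_norm_bound_integral)
    show "integrable lborel (\<lambda>z. f z * of_real (poisson_kernel t (x - z)))"
    proof (rule integrable_mult_bounded[OF f])
      show "norm (complex_of_real (poisson_kernel t (x - z))) \<le> 1 / (pi * t)" for z
        using poisson_kernel_le[OF t] poisson_kernel_nonneg[OF t] by simp
    qed measurable
  qed (use f norm_pconv_integrand_le[OF t] in auto)
  then show ?thesis unfolding bounded_iff by blast
qed

text \<open>Existence: both sides of the defining identity are the double integral of f(z) \<phi>(w)
  P_t(w - z), taken in different orders. Uniqueness: the difference of two candidates is continuous
  and bounded, and its integral against every Schwartz function is 0.\<close>

lemma poisson_conv_distr_of:
  assumes f: "integrable lborel f" and t: "t > 0"
  shows "poisson_conv (distr_of f) t = pconv f t"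
proof -
  have [measurable]: "f \<in> borel_measurable borel" using f by (auto dest: borel_measurable_integrable)
  have eq: "(LINT y|lborel. pconv f t y * \<phi> y) =
        (LINT y|lborel. distr_conv (distr_of f) (\<lambda>x. \<phi> (- x)) y * of_real (poisson_kernel t (- y)))"
    if \<phi>: "schwartz \<phi>" for \<phi>
  proof -
    note [measurable] = schwartz_measurable[OF \<phi>]
    define B where "B = schwartz_seminorm 0 0 \<phi>"
    have B: "norm (\<phi> x) \<le> B" for x using schwartz_bound[OF \<phi>] by (simp add: B_def)
    have B0: "B \<ge> 0" using order.trans[OF norm_ge_zero B[of 0]] .
    \<comment> \<open>The integrand of the distributional side after replacing y by -y. In these
      variables it is dominated by the product B P_t(y) |f(z)|, hence integrable on the
      plane.\<close>
    define h where "h = (\<lambda>y z. f z * \<phi> (z + y) * of_real (poisson_kernel t y))"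
    have int1: "integrable (lborel \<Otimes>\<^sub>M lborel) (\<lambda>(y, z). h y z)"
    proof (rule Bochner_Integration.integrable_bound)
      show "integrable (lborel \<Otimes>\<^sub>M lborel) (\<lambda>(y, z). B * (poisson_kernel t y * norm (f z)))"
      proof -
        have "integrable (lborel \<Otimes>\<^sub>M lborel) (\<lambda>p. B * (case p of (y, z) \<Rightarrow> poisson_kernel t y * norm (f z)))"
          by (intro integrable_mult_right integrable_lborel_pair_mult integrable_poisson_kernel integrable_norm f t)
        then show ?thesis
          by (rule back_subst[of "integrable (lborel \<Otimes>\<^sub>M lborel)"]) auto
      qed
      show "AE p in lborel \<Otimes>\<^sub>M lborel. norm (case p of (y, z) \<Rightarrow> h y z) \<le> norm (case p of (y, z) \<Rightarrow> B * (poisson_kernel t y * norm (f z)))"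
      proof (rule AE_I2, clarify)
        fix y z
        have "norm (\<phi> (z + y)) * (norm (f z) * poisson_kernel t y) \<le> B * (norm (f z) * poisson_kernel t y)"
          by (intro mult_right_mono B mult_nonneg_nonneg poisson_kernel_nonneg t) auto
        then show "norm (h y z) \<le> norm (B * (poisson_kernel t y * norm (f z)))"
          using poisson_kernel_nonneg[OF t, of y] B0
          by (simp add: h_def norm_mult mult_ac abs_mult)
      qed
    qed (simp add: h_def)
    have "(LINT y|lborel. distr_conv (distr_of f) (\<lambda>x. \<phi> (- x)) y * of_real (poisson_kernel t (- y))) =
       (LINT y|lborel. LINT z|lborel. f z * \<phi> (z - y) * of_real (poisson_kernel t (- y)))"
      by (simp add: distr_conv_def distr_of_def)
    also have "\<dots> = (LINT y|lborel. LINT z|lborel. h y z)"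
      by (subst lborel_integral_real_affine[of "-1" _ 0]) (auto simp: h_def)
    also have "\<dots> = (LINT z|lborel. LINT y|lborel. h y z)"
      by (rule lborel_pair.Fubini_integral[symmetric]) (rule int1)
    finally have R: "(LINT y|lborel. distr_conv (distr_of f) (\<lambda>x. \<phi> (- x)) y * of_real (poisson_kernel t (- y))) =
       (LINT z|lborel. LINT y|lborel. h y z)" .
    have sh: "(LINT y|lborel. h y z) = (LINT w|lborel. f z * \<phi> w * of_real (poisson_kernel t (w - z)))" for z
      by (subst lborel_integral_real_affine[of 1 "\<lambda>w. f z * \<phi> w * of_real (poisson_kernel t (w - z))" z]) (auto simp: h_def)
    \<comment> \<open>The same integrand with w = z + y. The bound is no longer a product, so
      \<open>w\<close> is integrated first: the integral of P_t(w - z) over \<open>w\<close> does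
      not depend on \<open>z\<close>.\<close>
    define k where "k = (\<lambda>z w. f z * \<phi> w * of_real (poisson_kernel t (w - z)))"
    have int2: "integrable (lborel \<Otimes>\<^sub>M lborel) (\<lambda>(z, w). k z w)"
    proof (rule integrableI_bounded)
      have pk: "(\<integral>\<^sup>+w. ennreal (poisson_kernel t (w - z)) \<partial>lborel) = (\<integral>\<^sup>+w. ennreal (poisson_kernel t w) \<partial>lborel)" for z
        by (subst nn_integral_real_affine[of "\<lambda>w. ennreal (poisson_kernel t (w - z))" 1 z]) auto
      have "(\<integral>\<^sup>+p. ennreal (norm (case p of (z, w) \<Rightarrow> k z w)) \<partial>(lborel \<Otimes>\<^sub>M lborel)) =
          (\<integral>\<^sup>+z. (\<integral>\<^sup>+w. ennreal (norm (k z w)) \<partial>lborel) \<partial>lborel)"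
        by (subst lborel.nn_integral_fst[symmetric]) (auto simp: k_def)
      also have "\<dots> \<le> (\<integral>\<^sup>+z. (\<integral>\<^sup>+w. ennreal (B * norm (f z)) * ennreal (poisson_kernel t (w - z)) \<partial>lborel) \<partial>lborel)"
      proof (intro nn_integral_mono)
        fix z w
        have "norm (\<phi> w) * (norm (f z) * poisson_kernel t (w - z)) \<le> B * (norm (f z) * poisson_kernel t (w - z))"
          by (intro mult_right_mono B mult_nonneg_nonneg poisson_kernel_nonneg t) auto
        then have "norm (k z w) \<le> (B * norm (f z)) * poisson_kernel t (w - z)"
          using poisson_kernel_nonneg[OF t, of "w - z"] by (simp add: k_def norm_mult mult_ac)
        then show "ennreal (norm (k z w)) \<le> ennreal (B * norm (f z)) * ennreal (poisson_kernel t (w - z))"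
          by (subst ennreal_mult''[symmetric]) (auto intro: poisson_kernel_nonneg t ennreal_leI)
      qed
      also have "\<dots> = (\<integral>\<^sup>+z. ennreal (norm (B * norm (f z))) \<partial>lborel) * (\<integral>\<^sup>+w. ennreal (norm (poisson_kernel t w)) \<partial>lborel)"
        using B0 poisson_kernel_nonneg[OF t]
        by (simp add: nn_integral_cmult nn_integral_multc pk abs_mult)
      also have "\<dots> < \<infinity>"
        using f integrable_poisson_kernel[OF t] integrable_mult_right[OF integrable_norm[OF f], of B]
        unfolding integrable_iff_bounded by (simp add: ennreal_mult_less_top)
      finally show "(\<integral>\<^sup>+p. ennreal (norm (case p of (z, w) \<Rightarrow> k z w)) \<partial>(lborel \<Otimes>\<^sub>M lborel)) < \<infinity>" .
    qed (simp add: k_def)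
    have "pconv f t w * \<phi> w = (LINT z|lborel. k z w)" for w
      unfolding pconv_def by (subst integral_mult_left_zero[symmetric]) (simp add: k_def mult_ac)
    then have "(LINT y|lborel. pconv f t y * \<phi> y) = (LINT w|lborel. LINT z|lborel. k z w)"
      by (simp only:)
    also have "\<dots> = (LINT z|lborel. LINT w|lborel. k z w)"
      by (rule lborel_pair.Fubini_integral) (rule int2)
    also have "\<dots> = (LINT z|lborel. LINT y|lborel. h y z)" by (simp add: sh k_def)
    finally show ?thesis using R by simp
  qed
  show ?thesis
    unfolding poisson_conv_def
  proof (rule the_equality, intro conjI allI impI eq)
    show "continuous_on UNIV (pconv f t)" "bounded (range (pconv f t))"
      using continuous_pconv[OF f t] bounded_pconv[OF f t] by auto
  next
    fix h
    assume h: "continuous_on UNIV h \<and> bounded (range h) \<and> (\<forall>\<phi>. schwartz \<phi> \<longrightarrow>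
        (LINT y|lborel. h y * \<phi> y) =
        (LINT y|lborel. distr_conv (distr_of f) (\<lambda>x. \<phi> (- x)) y * of_real (poisson_kernel t (- y))))"
    have "h x - pconv f t x = 0" for x
    proof (rule continuous_bounded_eq_0_if_schwartz_integrals_eq_0[where d = "\<lambda>x. h x - pconv f t x"])
      show "continuous_on UNIV (\<lambda>x. h x - pconv f t x)"
        using h continuous_pconv[OF f t] by (intro continuous_intros) auto
      show "bounded (range (\<lambda>x. h x - pconv f t x))"
        using h bounded_pconv[OF f t] by (intro bounded_minus_comp) auto
      fix \<phi> :: "real \<Rightarrow> complex" assume \<phi>: "schwartz \<phi>"
      have i: "integrable lborel (\<lambda>y. g y * \<phi> y)" if g: "continuous_on UNIV g" "bounded (range g)" for g
      proof -
        obtain C where C: "\<And>y. norm (g y) \<le> C" using g(2) by (auto simp: bounded_iff)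
        then show ?thesis
          using integrable_mult_bounded[OF schwartz_integrable[OF \<phi>] borel_measurable_continuous_onI[OF g(1)] C]
          by (simp add: mult.commute)
      qed
      show "(LINT y|lborel. (h y - pconv f t y) * \<phi> y) = 0"
        using h \<phi> eq[OF \<phi>] i[of h] i[OF continuous_pconv[OF f t] bounded_pconv[OF f t]]
        by (simp add: left_diff_distrib)
    qed
    then show "h = pconv f t" by (auto simp: fun_eq_iff)
  qed
qed

lemma bounded_distribution_distr_of:
  assumes f: "integrable lborel f"
  shows "bounded_distribution (distr_of f)"
proof -
  define N where "N = (LINT x|lborel. norm (f x))"
  have i: "integrable lborel (\<lambda>x. f x * \<phi> x)" if "schwartz \<phi>" for \<phi>
    by (rule integrable_mult_bounded[OF f schwartz_measurable[OF that] schwartz_bound[OF that]])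
  have le: "norm (LINT x|lborel. f x * g x) \<le> N * C" if "g \<in> borel_measurable borel" "\<And>x. norm (g x) \<le> C" for g C
  proof -
    have "norm (LINT x|lborel. f x * g x) \<le> (LINT x|lborel. norm (f x) * C)"
      using that f by (intro Bochner_Integration.integral_norm_bound_integral integrable_mult_bounded[OF f that])
        (auto simp: norm_mult intro!: mult_left_mono)
    then show ?thesis by (simp add: N_def)
  qed
  show ?thesis
    unfolding bounded_distribution_def tempered_distribution_def
  proof (intro conjI allI impI)
    fix \<phi> \<psi> assume "schwartz \<phi>" "schwartz \<psi>"
    then show "distr_of f (\<lambda>x. \<phi> x + \<psi> x) = distr_of f \<phi> + distr_of f \<psi>"
      by (simp add: distr_of_def ring_distribs i)
  next
    fix c \<phi>
    have "(\<lambda>x. f x * (c * \<phi> x)) = (\<lambda>x. c * (f x * \<phi> x))" by (simp add: mult_ac)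
    then show "distr_of f (\<lambda>x. c * \<phi> x) = c * distr_of f \<phi>" by (simp add: distr_of_def)
  next
    \<comment> \<open>The distribution has order 0: it is bounded by the L^1 norm \<open>N\<close>
      of \<open>f\<close> times the supremum norm of \<phi>.\<close>
    show "\<exists>C n. \<forall>\<phi>. schwartz \<phi> \<longrightarrow> norm (distr_of f \<phi>) \<le> C * (\<Sum>j\<le>n. \<Sum>k\<le>n. schwartz_seminorm j k \<phi>)"
      using le schwartz_measurable schwartz_bound
      by (intro exI[of _ N] exI[of _ 0]) (auto simp: distr_of_def)
  next
    fix \<phi> assume \<phi>: "schwartz \<phi>"
    have "norm (distr_conv (distr_of f) \<phi> x) \<le> N * schwartz_seminorm 0 0 \<phi>" for x
      unfolding distr_conv_def distr_of_def
      using schwartz_measurable[OF \<phi>] schwartz_bound[OF \<phi>] by (intro le) auto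
    then show "\<exists>C. AE x in lborel. norm (distr_conv (distr_of f) \<phi> x) \<le> C" by blast
  qed
qed

text \<open>The supremum runs over uncountably many \<open>t\<close>, but a supremum of continuous
  functions is lower semicontinuous: its superlevel sets are open.\<close>

lemma borel_measurable_poisson_maximal:
  assumes f: "integrable lborel f"
  shows "poisson_maximal (distr_of f) \<in> borel_measurable borel"
proof (rule borel_measurableI_greater)
  fix y
  have "{x \<in> space borel. y < poisson_maximal (distr_of f) x} = (\<Union>t\<in>{0<..}. {x. y < ennreal (norm (pconv f t x))})"
    by (auto simp: poisson_maximal_def less_SUP_iff poisson_conv_distr_of[OF f])
  also have "open \<dots>"
  proof (intro open_UN ballI)
    fix t :: real assume "t \<in> {0<..}"
    then have "continuous_on UNIV (\<lambda>x. ennreal (norm (pconv f t x)))"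
      by (intro continuous_on_ennreal continuous_intros continuous_pconv f) auto
    then show "open {x. y < ennreal (norm (pconv f t x))}"
      by (intro open_Collect_less continuous_on_const)
  qed
  finally show "{x \<in> space borel. y < poisson_maximal (distr_of f) x} \<in> sets borel" by simp
qed

section \<open>Averages of dilations on the Hardy space\<close>

lemma nn_integral_dilate:
  fixes g :: "real \<Rightarrow> ennreal"
  assumes [measurable]: "g \<in> borel_measurable borel" and u: "u > 0"
  shows "(\<integral>\<^sup>+x. g (x * u) \<partial>lborel) = ennreal (1 / u) * (\<integral>\<^sup>+x. g x \<partial>lborel)"
proof -
  have "(\<integral>\<^sup>+x. g x \<partial>lborel) = ennreal u * (\<integral>\<^sup>+x. g (x * u) \<partial>lborel)"
    using u by (subst nn_integral_real_affine[of g u 0]) (auto simp: mult.commute)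
  then have "ennreal (1 / u) * (\<integral>\<^sup>+x. g x \<partial>lborel) = (ennreal (1 / u) * ennreal u) * (\<integral>\<^sup>+x. g (x * u) \<partial>lborel)"
    by (simp only: mult.assoc)
  also have "ennreal (1 / u) * ennreal u = 1" using u by (simp flip: ennreal_mult')
  finally show ?thesis by simp
qed

text \<open>The substitution z = y u together with P_t(v/u) = u P_(t u)(v). A dilation of
  \<open>f\<close> becomes a change of the Poisson parameter, over which the maximal function takes
  its supremum.\<close>

lemma integral_dilate_poisson:
  assumes "u > 0" "t > 0"
  shows "(LINT y|lborel. f (y * u) * of_real (poisson_kernel t (x - y))) = pconv f (t * u) (x * u)"
proof -
  have "pconv f (t * u) (x * u) = \<bar>u\<bar> *\<^sub>R (LINT y|lborel. f (0 + u * y) * of_real (poisson_kernel (t * u) (x * u - (0 + u * y))))"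
    unfolding pconv_def by (rule lborel_integral_real_affine) (use assms in auto)
  also have "\<dots> = (LINT y|lborel. u *\<^sub>R (f (0 + u * y) * of_real (poisson_kernel (t * u) (x * u - (0 + u * y)))))"
    using assms by simp
  also have "\<dots> = (LINT y|lborel. f (y * u) * of_real (poisson_kernel t (x - y)))"
  proof (intro Bochner_Integration.integral_cong refl)
    fix y
    have "(x * u - (0 + u * y)) / u = x - y" using assms by (simp add: field_simps)
    then have "poisson_kernel t (x - y) = u * poisson_kernel (t * u) (x * u - (0 + u * y))"
      using poisson_kernel_dilate[OF assms, of "x * u - (0 + u * y)"] by simp
    then show "u *\<^sub>R (f (0 + u * y) * of_real (poisson_kernel (t * u) (x * u - (0 + u * y)))) = f (y * u) * of_real (poisson_kernel t (x - y))"
      by (simp add: scaleR_conv_of_real mult_ac)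
  qed
  finally show ?thesis ..
qed

text \<open>The Hardy space argument for any kernel on the positive half-line with finite integral
  of |K(u)|/u. Extending \<open>K\<close> by 0 lets Fubini's theorem run over the whole
  plane.\<close>

lemma hardy_dilation_average:
  fixes K :: "real \<Rightarrow> complex"
  assumes K [measurable]: "K \<in> borel_measurable borel" and K0: "\<And>u. u \<le> 0 \<Longrightarrow> K u = 0"
    and Kint: "integrable lborel (\<lambda>u. norm (K u) / u)" and f: "f \<in> hardy_space"
  defines "Tf \<equiv> \<lambda>x. LINT u|lborel. K u * f (x * u)"
  shows "AE x in lborel. integrable lborel (\<lambda>u. K u * f (x * u))"
    and "Tf \<in> hardy_space"
    and "hardy_norm Tf \<le> ennreal (LINT u|lborel. norm (K u) / u) * hardy_norm f"
proof -
  have fi: "integrable lborel f" and M [measurable]: "poisson_maximal (distr_of f) \<in> borel_measurable borel"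
    and Mfin: "(\<integral>\<^sup>+x. poisson_maximal (distr_of f) x \<partial>lborel) < \<infinity>"
    using f by (auto simp: hardy_space_def hardy_distribution_def)
  have fm [measurable]: "f \<in> borel_measurable borel" using fi by (auto dest: borel_measurable_integrable)
  \<comment> \<open>Applied to |f| for the convergence of \<open>Tf\<close>, and to the maximal
    function of \<open>f\<close> for the norm. The weight 1/u is the Jacobian of the
    dilation.\<close>
  have nn_swap: "(\<integral>\<^sup>+x. (\<integral>\<^sup>+u. ennreal (norm (K u)) * g (x * u) \<partial>lborel) \<partial>lborel) =
      ennreal (LINT u|lborel. norm (K u) / u) * (\<integral>\<^sup>+x. g x \<partial>lborel)"
    if [measurable]: "g \<in> borel_measurable borel" for g
  proof -
    have "(\<integral>\<^sup>+x. (\<integral>\<^sup>+u. ennreal (norm (K u)) * g (x * u) \<partial>lborel) \<partial>lborel) =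
       (\<integral>\<^sup>+u. (\<integral>\<^sup>+x. ennreal (norm (K u)) * g (x * u) \<partial>lborel) \<partial>lborel)"
      by (rule lborel_pair.Fubini'[symmetric]) measurable
    also have "\<dots> = (\<integral>\<^sup>+u. ennreal (norm (K u) / u) * (\<integral>\<^sup>+x. g x \<partial>lborel) \<partial>lborel)"
    proof (rule nn_integral_cong)
      fix u :: real
      have "(\<integral>\<^sup>+x. ennreal (norm (K u)) * g (x * u) \<partial>lborel) = ennreal (norm (K u)) * (\<integral>\<^sup>+x. g (x * u) \<partial>lborel)"
        by (rule nn_integral_cmult) measurable
      then show "(\<integral>\<^sup>+x. ennreal (norm (K u)) * g (x * u) \<partial>lborel) = ennreal (norm (K u) / u) * (\<integral>\<^sup>+x. g x \<partial>lborel)"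
        using K0[of u] nn_integral_dilate[of g u]
        by (cases "u > 0") (auto simp: divide_inverse ennreal_mult' mult.assoc)
    qed
    also have "\<dots> = (\<integral>\<^sup>+u. ennreal (norm (K u) / u) \<partial>lborel) * (\<integral>\<^sup>+x. g x \<partial>lborel)"
      by (rule nn_integral_multc) measurable
    also have "(\<integral>\<^sup>+u. ennreal (norm (K u) / u) \<partial>lborel) = ennreal (LINT u|lborel. norm (K u) / u)"
    proof (rule nn_integral_eq_integral[OF Kint], rule AE_I2)
      show "0 \<le> norm (K u) / u" for u using K0[of u] by (cases "u \<le> 0") auto
    qed
    finally show ?thesis .
  qed
  have int: "integrable (lborel \<Otimes>\<^sub>M lborel) (\<lambda>(x, u). K u * f (x * u))"
  proof (rule integrableI_bounded)
    have "(\<integral>\<^sup>+p. ennreal (norm (case p of (x, u) \<Rightarrow> K u * f (x * u))) \<partial>(lborel \<Otimes>\<^sub>M lborel)) =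
        (\<integral>\<^sup>+x. (\<integral>\<^sup>+u. ennreal (norm (K u)) * ennreal (norm (f (x * u))) \<partial>lborel) \<partial>lborel)"
      by (subst lborel.nn_integral_fst[symmetric]) (auto simp: norm_mult ennreal_mult')
    also have "\<dots> < \<infinity>"
      using fi by (subst nn_swap) (auto simp: integrable_iff_bounded ennreal_mult_less_top)
    finally show "(\<integral>\<^sup>+p. ennreal (norm (case p of (x, u) \<Rightarrow> K u * f (x * u))) \<partial>(lborel \<Otimes>\<^sub>M lborel)) < \<infinity>" .
  qed measurable
  show "AE x in lborel. integrable lborel (\<lambda>u. K u * f (x * u))"
    using lborel_pair.AE_integrable_fst'[OF int] by simp
  have Ti: "integrable lborel Tf"
    using lborel_pair.integrable_fst'[OF int] by (simp add: Tf_def)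
  \<comment> \<open>Poisson integration commutes with the average by Fubini's theorem; since P_t
    \<le> 1/(pi t), the integrability in \<open>int\<close> supplies the dominating
    function.\<close>
  have pT: "pconv Tf t x = (LINT u|lborel. K u * pconv f (t * u) (x * u))" if t: "t > 0" for t x
  proof -
    define k where "k = (\<lambda>y u. K u * f (y * u) * of_real (poisson_kernel t (x - y)))"
    have int': "integrable (lborel \<Otimes>\<^sub>M lborel) (\<lambda>(y, u). k y u)"
    proof (rule Bochner_Integration.integrable_bound)
      show "integrable (lborel \<Otimes>\<^sub>M lborel) (\<lambda>p. norm (case p of (x, u) \<Rightarrow> K u * f (x * u)) * (1 / (pi * t)))"
        by (intro integrable_mult_left integrable_norm int)
      show "AE p in lborel \<Otimes>\<^sub>M lborel. norm (case p of (y, u) \<Rightarrow> k y u) \<le>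
          norm (norm (case p of (x, u) \<Rightarrow> K u * f (x * u)) * (1 / (pi * t)))"
      proof (rule AE_I2, clarify)
        fix y u
        show "norm (k y u) \<le> norm (norm (K u * f (y * u)) * (1 / (pi * t)))"
          using norm_pconv_integrand_le[OF t, of "\<lambda>y. K u * f (y * u)" y x] t
          by (simp add: k_def)
      qed
    qed (simp add: k_def)
    have "Tf y * of_real (poisson_kernel t (x - y)) = (LINT u|lborel. k y u)" for y
      unfolding Tf_def k_def by (rule integral_mult_left_zero[symmetric])
    then have "pconv Tf t x = (LINT y|lborel. LINT u|lborel. k y u)"
      unfolding pconv_def by (simp only:)
    also have "\<dots> = (LINT u|lborel. LINT y|lborel. k y u)"
      by (rule lborel_pair.Fubini_integral[symmetric]) (rule int')
    also have "\<dots> = (LINT u|lborel. K u * pconv f (t * u) (x * u))"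
    proof (intro Bochner_Integration.integral_cong refl)
      fix u :: real
      have "(LINT y|lborel. k y u) = K u * (LINT y|lborel. f (y * u) * of_real (poisson_kernel t (x - y)))"
        unfolding k_def mult.assoc by (rule integral_mult_right_zero)
      then show "(LINT y|lborel. k y u) = K u * pconv f (t * u) (x * u)"
        using K0[of u] integral_dilate_poisson[OF _ t, of u f x] by (cases "u > 0") auto
    qed
    finally show ?thesis .
  qed
  \<comment> \<open>For \<open>u > 0\<close> the parameter \<open>t * u\<close> is again positive,
    so each dilated Poisson integral is below the maximal function of \<open>f\<close> at
    \<open>x * u\<close>, uniformly in \<open>t\<close>.\<close>
  have le: "poisson_maximal (distr_of Tf) x \<le> (\<integral>\<^sup>+u. ennreal (norm (K u)) * poisson_maximal (distr_of f) (x * u) \<partial>lborel)" for x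
    unfolding poisson_maximal_def[of "distr_of Tf"]
  proof (rule SUP_least)
    fix t :: real assume "t \<in> {0<..}"
    then have t: "t > 0" by simp
    have "ennreal (norm (poisson_conv (distr_of Tf) t x)) \<le> (\<integral>\<^sup>+u. ennreal (norm (K u * pconv f (t * u) (x * u))) \<partial>lborel)"
      unfolding poisson_conv_distr_of[OF Ti t] pT[OF t] by (rule norm_integral_le_nn_integral)
    also have "\<dots> \<le> (\<integral>\<^sup>+u. ennreal (norm (K u)) * poisson_maximal (distr_of f) (x * u) \<partial>lborel)"
    proof (rule nn_integral_mono)
      fix u :: real
      show "ennreal (norm (K u * pconv f (t * u) (x * u))) \<le> ennreal (norm (K u)) * poisson_maximal (distr_of f) (x * u)"
      proof (cases "u > 0")
        case True
        then have "ennreal (norm (pconv f (t * u) (x * u))) \<le> poisson_maximal (distr_of f) (x * u)"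
          unfolding poisson_maximal_def using t
          by (intro SUP_upper2[of "t * u"]) (auto simp: poisson_conv_distr_of[OF fi])
        then show ?thesis by (simp add: norm_mult ennreal_mult' mult_left_mono)
      qed (use K0[of u] in auto)
    qed
    finally show "ennreal (norm (poisson_conv (distr_of Tf) t x)) \<le>
        (\<integral>\<^sup>+u. ennreal (norm (K u)) * poisson_maximal (distr_of f) (x * u) \<partial>lborel)" .
  qed
  have "hardy_norm Tf \<le> (\<integral>\<^sup>+x. (\<integral>\<^sup>+u. ennreal (norm (K u)) * poisson_maximal (distr_of f) (x * u) \<partial>lborel) \<partial>lborel)"
    unfolding hardy_norm_def by (intro nn_integral_mono le)
  also have "\<dots> = ennreal (LINT u|lborel. norm (K u) / u) * hardy_norm f"
    unfolding hardy_norm_def by (rule nn_swap[OF M])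
  finally show bound: "hardy_norm Tf \<le> ennreal (LINT u|lborel. norm (K u) / u) * hardy_norm f" .
  \<comment> \<open>Finiteness of the norm yields membership: an integrable function always defines
    a bounded distribution with measurable maximal function.\<close>
  also have "\<dots> < \<infinity>" using Mfin by (simp add: hardy_norm_def ennreal_mult_less_top)
  finally show "Tf \<in> hardy_space"
    using Ti bounded_distribution_distr_of[OF Ti] borel_measurable_poisson_maximal[OF Ti]
    by (simp add: hardy_space_def hardy_distribution_def hardy_norm_def)
qed

section \<open>The operator\<close>

text \<open>Beyond the bound, the conclusion states that the integral for the constant converges and
  that the operator's integral converges absolutely for almost every \<open>x\<close>. Otherwise
  \<open>const_k1\<close> or \<open>op_I\<close> might be the default value 0 of a divergent
  integral, and the bound would say something else than intended.\<close>

theorem theorem3p1: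
  fixes m :: nat and \<beta> lam \<gamma> \<delta> :: "nat \<Rightarrow> real" and f :: "real \<Rightarrow> complex"
  assumes "m \<ge> 1"
    and "\<And>k. k \<in> {1..m} \<Longrightarrow> \<beta> k > 0"
    and "\<And>k. k \<in> {1..m} \<Longrightarrow> lam k > 0"
    and "\<And>k. k \<in> {1..m} \<Longrightarrow> \<delta> k \<ge> 0"
    and "(\<Sum>k=1..m. 1 / lam k) = (\<Sum>k=1..m. 1 / \<beta> k)"
    and "(\<Sum>k=1..m. \<delta> k) > 0"
    and "(MIN k\<in>{1..m}. (\<gamma> k + 1) * lam k) > 1"
    and "f \<in> hardy_space"
  shows "set_integrable lborel {0<..<1} (\<lambda>\<sigma>. norm (kernel_H m \<beta> lam \<gamma> \<delta> \<sigma>) / \<sigma>)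
    \<and> (AE x in lborel. set_integrable lborel {0<..<1} (\<lambda>u. kernel_H m \<beta> lam \<gamma> \<delta> u * f (x * u)))
    \<and> op_I m \<beta> lam \<gamma> \<delta> f \<in> hardy_space
    \<and> hardy_norm (op_I m \<beta> lam \<gamma> \<delta> f) \<le> ennreal (const_k1 m \<beta> lam \<gamma> \<delta>) * hardy_norm f"
proof -
  define a b A B where "a = (\<lambda>k. \<gamma> k + \<delta> k + 1 - 1 / \<beta> k)" and "b = (\<lambda>k. \<gamma> k + 1 - 1 / lam k)"
    and "A = (\<lambda>k. 1 / \<beta> k)" and "B = (\<lambda>k. 1 / lam k)"
  note defs = a_def b_def A_def B_def
  \<comment> \<open>The condition on the minimum, divided by \<open>lam k\<close>; it makes every
    pole of the numerator negative.\<close>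
  have b: "b k > 0" if k: "k \<in> {1..m}" for k
  proof -
    have "(MIN k\<in>{1..m}. (\<gamma> k + 1) * lam k) \<le> (\<gamma> k + 1) * lam k"
      using k by (intro Min_le) auto
    then have "1 < (\<gamma> k + 1) * lam k" using assms(7) by linarith
    then show ?thesis using assms(3)[OF k] by (simp add: b_def field_simps)
  qed
  \<comment> \<open>The reciprocals contained in \<open>a\<close> and \<open>b\<close> cancel by the
    same equality that gives \<open>AB\<close>, so \<Delta> is the sum of the \<delta>_k.\<close>
  have "(\<Sum>k=1..m. a k - b k) = (\<Sum>k=1..m. \<delta> k) + ((\<Sum>k=1..m. 1 / lam k) - (\<Sum>k=1..m. 1 / \<beta> k))"
    unfolding sum_subtractf[symmetric] sum.distrib[symmetric] by (intro sum.cong) (auto simp: a_def b_def)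
  then have ab: "(\<Sum>k=1..m. a k - b k) > 0" using assms(5,6) by simp
  interpret fox_kernel m a b A B
    using assms(1,2,3,5) b ab by unfold_locales (auto simp: A_def B_def)
  define H where "H = kernel_H m \<beta> lam \<gamma> \<delta>"
  define K where "K = (\<lambda>u. indicator {0<..<1} u *\<^sub>R H u)"
  have H: "H u = fox_H m (\<lambda>k. of_real (a k)) A (\<lambda>k. of_real (b k)) B (of_real u)" for u
    by (simp add: H_def kernel_H_def defs)
  have Km: "K \<in> borel_measurable borel"
    using fox_H_measurable_integrable(1) by (simp add: K_def H)
  have Hint: "set_integrable lborel {0<..<1} (\<lambda>u. norm (H u) / u)"
    using fox_H_measurable_integrable(2) by (simp add: H)
  have K_eq: "(\<lambda>u. norm (K u) / u) = (\<lambda>u. indicator {0<..<1} u *\<^sub>R (norm (H u) / u))"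
    by (auto simp: K_def fun_eq_iff)
  have Kint: "integrable lborel (\<lambda>u. norm (K u) / u)"
    using Hint unfolding K_eq set_integrable_def .
  have k1: "(LINT u|lborel. norm (K u) / u) = const_k1 m \<beta> lam \<gamma> \<delta>"
    unfolding K_eq const_k1_def set_lebesgue_integral_def H_def ..
  have KH: "(\<lambda>u. K u * f (x * u)) = (\<lambda>u. indicator {0<..<1} u *\<^sub>R (H u * f (x * u)))" for x
    by (auto simp: K_def)
  have op: "op_I m \<beta> lam \<gamma> \<delta> f = (\<lambda>x. LINT u|lborel. K u * f (x * u))"
    by (simp add: KH fun_eq_iff op_I_def set_lebesgue_integral_def H_def)
  have K0: "K u = 0" if "u \<le> 0" for u using that by (simp add: K_def)
  note avg = hardy_dilation_average[OF Km K0 Kint assms(8)]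
  have "AE x in lborel. set_integrable lborel {0<..<1} (\<lambda>u. H u * f (x * u))"
    using avg(1) unfolding KH set_integrable_def .
  then show ?thesis
    using Hint avg(2,3) unfolding op k1 H_def by blast
qed

end
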